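(* Let $G$ be a graph with at least $6$ vertices that is generically redundantly rigid in $\mathbb{R}^5$ and $6$-connected. Then $G\cup_{2,4} C_{2,3,5,4}$ is generically partially rigid in $\mathbb{R}^5$.
   Context: All graphs are finite and simple. The $4$-chain $C_{2,3,5,4}$ has vertex set the union of pairwise disjoint sets $A_1,A_2,A_3,A_4$ of sizes $2,3,5,4$, every vertex of $A_i$ is adjacent to every vertex of $A_{i+1}$ for $i=1,2,3$, and there are no other edges. For a graph $G=(V,E)$ with at least $6$ vertices, $G\cup_{2,4}C_{2,3,5,4}$ denotes a graph obtained by attaching $C_{2,3,5,4}$ to $G$: $A_1$ and $A_4$ are taken to be disjoint $2$-element and $4$-element subsets of $V$ (any choice), no vertex of $A_2$ or $A_3$ lies in $V$, and the edges are precisely all edges of $G$ and all edges of $C_{2,3,5,4}$. A realization of a graph $G=(V,E)$ with $v$ vertices in $\mathbb{R}^d$ is $p=(p_1,\dots,p_v)\in\mathbb{R}^{vd}$, where $p_i\in\mathbb{R}^d$ is the location of the $i$-th vertex; it defines the framework $G(p)$. Put $f_G(p)=\frac12(\ldots,|p_i-p_j|^2,\ldots)_{\{i,j\}\in E}\in\mathbb{R}^{E}$. A realization is generic if its coordinates are algebraically independent over $\mathbb{Q}$. A flexing of $G(p)$ is a differentiable one-parameter family of realizations including $p$ such that $f_G(q)=f_G(p)$ for all $q$ in the family; $G(p)$ is locally rigid if all its flexings are trivial (come from Euclidean motions). $G(p)$ is globally rigid if for every realization $q$ in $\mathbb{R}^d$, $f_G(p)=f_G(q)$ implies $|p_i-p_j|=|q_i-q_j|$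 for all pairs of vertices $i,j$. An edge of a framework is redundant if removing it leaves a locally rigid framework; a framework is redundantly rigid if all of its edges are redundant. These properties do not depend on which generic realization is chosen; $G$ is called generically locally rigid, generically redundantly rigid, or generically globally rigid in $\mathbb{R}^d$ if its generic frameworks in $\mathbb{R}^d$ are respectively locally, redundantly, or globally rigid. A graph is $(d+1)$-connected if it has at least $d+2$ vertices and removing any at most $d$ vertices leaves a connected graph. A graph is generically partially rigid in $\mathbb{R}^d$ if it is $(d+1)$-connected and generically redundantly rigid in $\mathbb{R}^d$ but not generically globally rigid in $\mathbb{R}^d$. *)

theory Defs
  imports "HOL-Analysis.Analysis" "HOL-Library.Poly_Mapping"
begin

record 'a graph =
  verts :: "'a set"
  edges :: "'a set set"

definition simple_graph :: "'a graph \<Rightarrow> bool" where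
  "simple_graph G \<longleftrightarrow>
     finite (verts G) \<and> (\<forall>e \<in> edges G. e \<subseteq> verts G \<and> card e = 2)"

definition graph_union :: "'a graph \<Rightarrow> 'a graph \<Rightarrow> 'a graph" where
  "graph_union G H = \<lparr>verts = verts G \<union> verts H, edges = edges G \<union> edges H\<rparr>"

definition remove_verts :: "'a graph \<Rightarrow> 'a set \<Rightarrow> 'a graph" where
  "remove_verts G S = \<lparr>verts = verts G - S, edges = {e \<in> edges G. e \<inter> S = {}}\<rparr>"

definition remove_edge :: "'a graph \<Rightarrow> 'a set \<Rightarrow> 'a graph" where
  "remove_edge G e = \<lparr>verts = verts G, edges = edges G - {e}\<rparr>"

definition graph_connected :: "'a graph \<Rightarrow> bool" where
  "graph_connected G \<longleftrightarrow>
     (\<forall>u \<in> verts G. \<forall>v \<in> verts G. (u, v) \<in> {(x, y). {x, y} \<in> edges G}\<^sup>*)"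

definition k_connected :: "nat \<Rightarrow> 'a graph \<Rightarrow> bool" where
  "k_connected k G \<longleftrightarrow>
     card (verts G) \<ge> k + 1 \<and>
     (\<forall>S \<subseteq> verts G. card S < k \<longrightarrow> graph_connected (remove_verts G S))"

definition four_chain :: "'a set \<Rightarrow> 'a set \<Rightarrow> 'a set \<Rightarrow> 'a set \<Rightarrow> 'a graph" where
  "four_chain A1 A2 A3 A4 =
     \<lparr>verts = A1 \<union> A2 \<union> A3 \<union> A4,
      edges = {{x, y} |x y. x \<in> A1 \<and> y \<in> A2} \<union>
              {{x, y} |x y. x \<in> A2 \<and> y \<in> A3} \<union>
              {{x, y} |x y. x \<in> A3 \<and> y \<in> A4}\<rparr>"

text \<open>
  The set of all graphs obtained by attaching a 4-chain with part sizes \<open>n1\<close>, \<open>n2\<close>, \<open>n3\<close>, \<open>n4\<close> to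
  \<open>G\<close> along its first and last part, for all choices of these parts in \<open>G\<close> and all choices
  of the new vertices.
\<close>

definition four_chain_attachments ::
    "nat \<Rightarrow> nat \<Rightarrow> nat \<Rightarrow> nat \<Rightarrow> 'a graph \<Rightarrow> 'a graph set" where
  "four_chain_attachments n1 n2 n3 n4 G =
     {graph_union G (four_chain A1 A2 A3 A4) |A1 A2 A3 A4.
        finite A1 \<and> finite A2 \<and> finite A3 \<and> finite A4 \<and>
        card A1 = n1 \<and> card A2 = n2 \<and> card A3 = n3 \<and> card A4 = n4 \<and>
        A1 \<inter> A2 = {} \<and> A1 \<inter> A3 = {} \<and> A1 \<inter> A4 = {} \<and>
        A2 \<inter> A3 = {} \<and> A2 \<inter> A4 = {} \<and> A3 \<inter> A4 = {} \<and>
        A1 \<subseteq> verts G \<and> A4 \<subseteq> verts G \<and>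
        A2 \<inter> verts G = {} \<and> A3 \<inter> verts G = {}}"

text \<open>
  The type \<open>('i \<Rightarrow>\<^sub>0 nat) \<Rightarrow>\<^sub>0 rat\<close> is the type of polynomials with rational coefficients in variables
  indexed by \<open>'i\<close>: the keys of a polynomial are its monomials, given by their exponents.
\<close>

definition eval_rat_mpoly :: "('i \<Rightarrow> real) \<Rightarrow> (('i \<Rightarrow>\<^sub>0 nat) \<Rightarrow>\<^sub>0 rat) \<Rightarrow> real" where
  "eval_rat_mpoly x P =
     (\<Sum>m \<in> Poly_Mapping.keys P. of_rat (Poly_Mapping.lookup P m) *
        (\<Prod>i \<in> Poly_Mapping.keys m. x i ^ Poly_Mapping.lookup m i))"

definition alg_independent_rat :: "'i set \<Rightarrow> ('i \<Rightarrow> real) \<Rightarrow> bool" where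
  "alg_independent_rat I x \<longleftrightarrow>
     (\<forall>P. (\<forall>m \<in> Poly_Mapping.keys P. Poly_Mapping.keys m \<subseteq> I) \<longrightarrow>
          eval_rat_mpoly x P = 0 \<longrightarrow> P = 0)"

text \<open>
  A realization of \<open>G\<close> is a function \<open>'a \<Rightarrow> real ^ 'n\<close> of which only the values on \<^term>\<open>verts G\<close>
  matter.
\<close>

definition generic_realization :: "'a graph \<Rightarrow> ('a \<Rightarrow> real ^ 'n) \<Rightarrow> bool" where
  "generic_realization G p \<longleftrightarrow>
     alg_independent_rat (verts G \<times> UNIV) (\<lambda>(v, k). p v $ k)"

text \<open>
  The map \<open>f\<^sub>G\<close>. Each edge \<open>{i, j}\<close> occurs as the two ordered pairs \<open>(i, j)\<close> and \<open>(j, i)\<close>,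
  which does not affect equality of measurements.
\<close>

definition measurement :: "'a graph \<Rightarrow> ('a \<Rightarrow> real ^ 'n) \<Rightarrow> 'a \<times> 'a \<Rightarrow> real" where
  "measurement G p =
     (\<lambda>(i, j) \<in> {(i, j). {i, j} \<in> edges G}. (norm (p i - p j))\<^sup>2 / 2)"

definition flexing ::
    "'a graph \<Rightarrow> ('a \<Rightarrow> real ^ 'n) \<Rightarrow> real set \<Rightarrow> (real \<Rightarrow> 'a \<Rightarrow> real ^ 'n) \<Rightarrow> bool" where
  "flexing G p T q \<longleftrightarrow>
     is_interval T \<and>
     (\<forall>v \<in> verts G. (\<lambda>t. q t v) differentiable_on T) \<and>
     (\<exists>t\<^sub>0 \<in> T. \<forall>v \<in> verts G. q t\<^sub>0 v = p v) \<and>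
     (\<forall>t \<in> T. measurement G (q t) = measurement G p)"

definition trivial_flexing ::
    "'a graph \<Rightarrow> ('a \<Rightarrow> real ^ 'n) \<Rightarrow> real set \<Rightarrow> (real \<Rightarrow> 'a \<Rightarrow> real ^ 'n) \<Rightarrow> bool" where
  "trivial_flexing G p T q \<longleftrightarrow>
     (\<forall>t \<in> T. \<exists>a R. orthogonal_transformation R \<and> (\<forall>v \<in> verts G. q t v = a + R (p v)))"

definition locally_rigid :: "'a graph \<Rightarrow> ('a \<Rightarrow> real ^ 'n) \<Rightarrow> bool" where
  "locally_rigid G p \<longleftrightarrow> (\<forall>T q. flexing G p T q \<longrightarrow> trivial_flexing G p T q)"

definition redundantly_rigid :: "'a graph \<Rightarrow> ('a \<Rightarrow> real ^ 'n) \<Rightarrow> bool" where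
  "redundantly_rigid G p \<longleftrightarrow> (\<forall>e \<in> edges G. locally_rigid (remove_edge G e) p)"

definition globally_rigid :: "'a graph \<Rightarrow> ('a \<Rightarrow> real ^ 'n) \<Rightarrow> bool" where
  "globally_rigid G p \<longleftrightarrow>
     (\<forall>q :: 'a \<Rightarrow> real ^ 'n. measurement G p = measurement G q \<longrightarrow>
        (\<forall>i \<in> verts G. \<forall>j \<in> verts G. norm (p i - p j) = norm (q i - q j)))"

definition generically_redundantly_rigid :: "'n::finite itself \<Rightarrow> 'a graph \<Rightarrow> bool" where
  "generically_redundantly_rigid _ G \<longleftrightarrow>
     (\<forall>p :: 'a \<Rightarrow> real ^ 'n. generic_realization G p \<longrightarrow> redundantly_rigid G p)"

definition generically_globally_rigid :: "'n::finite itself \<Rightarrow> 'a graph \<Rightarrow> bool" where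
  "generically_globally_rigid _ G \<longleftrightarrow>
     (\<forall>p :: 'a \<Rightarrow> real ^ 'n. generic_realization G p \<longrightarrow> globally_rigid G p)"

definition generically_partially_rigid :: "'n::finite itself \<Rightarrow> 'a graph \<Rightarrow> bool" where
  "generically_partially_rigid d G \<longleftrightarrow>
     k_connected (CARD('n) + 1) G \<and> generically_redundantly_rigid d G \<and>
     \<not> generically_globally_rigid d G"

end

theory Submission
  imports Defs
begin

text \<open>
  With the ends \<open>A\<^sub>1\<close>, \<open>A\<^sub>4\<close> pinned, the 8 inner vertices of the chain have 40 degrees of freedom and 41
  edges.  The 7 points of \<open>A\<^sub>1 \<union> A\<^sub>3\<close> and the 7 points of \<open>A\<^sub>2 \<union> A\<^sub>4\<close> have one affine dependency each,
  and the products of their coefficients form a self-stress which vanishes on no edge.  Hence it suffices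
  to exhibit one infinitesimally rigid position of the pinned chain: then almost all positions
  are infinitesimally rigid, even after removal of an edge, and redundant rigidity follows from that of \<open>G\<close>.

  For the failure of global rigidity, consider the positions of the chain with given affine dependencies.
  They form an affine space of dimension 30, on which the 41 lengths satisfy 11 independent linear relations.
  If \<open>p\<close> and \<open>q\<close> are equivalent, not congruent, have the same dependencies, and \<open>q\<close> is infinitesimally
  rigid, then by the open mapping theorem every \<open>p'\<close> near \<open>p\<close>, in particular a generic one, has an equivalent
  \<open>q'\<close> near \<open>q\<close>.  Such a pair is obtained from Dixon's mechanism of points on two orthogonal lines.
\<close>

subsection \<open>Polynomials with rational coefficients and generic points\<close>

lemma prod_power_lookup_superset:
  fixes x :: "'i \<Rightarrow> real"
  assumes "finite S" "Poly_Mapping.keys m \<subseteq> S"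
  shows "(\<Prod>i\<in>Poly_Mapping.keys m. x i ^ Poly_Mapping.lookup m i) = (\<Prod>i\<in>S. x i ^ Poly_Mapping.lookup m i)"
  by (rule prod.mono_neutral_left) (use assms in \<open>auto simp: in_keys_iff\<close>)

lemma eval_rat_mpoly_superset:
  assumes "finite S" "Poly_Mapping.keys P \<subseteq> S"
  shows "eval_rat_mpoly x P = (\<Sum>m\<in>S. of_rat (Poly_Mapping.lookup P m) *
    (\<Prod>i\<in>Poly_Mapping.keys m. x i ^ Poly_Mapping.lookup m i))"
  unfolding eval_rat_mpoly_def
  by (rule sum.mono_neutral_left) (use assms in \<open>auto simp: in_keys_iff\<close>)

lemma eval_rat_mpoly_0 [simp]: "eval_rat_mpoly x 0 = 0"
  by (simp add: eval_rat_mpoly_def)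

lemma eval_rat_mpoly_single:
  "eval_rat_mpoly x (Poly_Mapping.single m c) =
    of_rat c * (\<Prod>i\<in>Poly_Mapping.keys m. x i ^ Poly_Mapping.lookup m i)"
  by (simp add: eval_rat_mpoly_superset[of "{m}"])

lemma eval_rat_mpoly_add:
  "eval_rat_mpoly x (P + Q) = eval_rat_mpoly x P + eval_rat_mpoly x Q"
proof -
  let ?S = "Poly_Mapping.keys P \<union> Poly_Mapping.keys Q"
  have "Poly_Mapping.keys (P + Q) \<subseteq> ?S"
    by (rule Poly_Mapping.keys_add)
  then show ?thesis
    by (simp add: eval_rat_mpoly_superset[of ?S] lookup_add of_rat_add ring_distribs sum.distrib)
qed

lemma eval_rat_mpoly_sum:
  "eval_rat_mpoly x (\<Sum>a\<in>A. f a) = (\<Sum>a\<in>A. eval_rat_mpoly x (f a))"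
  by (induction A rule: infinite_finite_induct) (auto simp: eval_rat_mpoly_add)

lemma prod_power_lookup_add:
  fixes x :: "'i \<Rightarrow> real"
  shows "(\<Prod>i\<in>Poly_Mapping.keys (m + n). x i ^ Poly_Mapping.lookup (m + n) i) =
    (\<Prod>i\<in>Poly_Mapping.keys m. x i ^ Poly_Mapping.lookup m i) *
    (\<Prod>i\<in>Poly_Mapping.keys n. x i ^ Poly_Mapping.lookup n i)"
proof -
  let ?S = "Poly_Mapping.keys m \<union> Poly_Mapping.keys n"
  have "Poly_Mapping.keys (m + n) \<subseteq> ?S"
    by (rule Poly_Mapping.keys_add)
  then show ?thesis
    by (subst (1 2 3) prod_power_lookup_superset[of ?S]) (auto simp: lookup_add power_add prod.distrib)
qed

lemma poly_mapping_eq_sum_single: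
  "P = (\<Sum>m\<in>Poly_Mapping.keys P. Poly_Mapping.single m (Poly_Mapping.lookup P m))"
  by (rule poly_mapping_eqI)
    (auto simp: lookup_sum lookup_single when_def in_keys_iff sum.delta)

lemma eval_rat_mpoly_mult:
  "eval_rat_mpoly x (P * Q) = eval_rat_mpoly x P * eval_rat_mpoly x Q"
proof -
  have "P * Q = (\<Sum>m\<in>Poly_Mapping.keys P. Poly_Mapping.single m (Poly_Mapping.lookup P m)) *
      (\<Sum>n\<in>Poly_Mapping.keys Q. Poly_Mapping.single n (Poly_Mapping.lookup Q n))"
    using poly_mapping_eq_sum_single by metis
  also have "\<dots> = (\<Sum>m\<in>Poly_Mapping.keys P. \<Sum>n\<in>Poly_Mapping.keys Q.
      Poly_Mapping.single (m + n) (Poly_Mapping.lookup P m * Poly_Mapping.lookup Q n))"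
    by (simp add: sum_product mult_single)
  finally have "eval_rat_mpoly x (P * Q) = (\<Sum>m\<in>Poly_Mapping.keys P. \<Sum>n\<in>Poly_Mapping.keys Q.
      (of_rat (Poly_Mapping.lookup P m) * (\<Prod>i\<in>Poly_Mapping.keys m. x i ^ Poly_Mapping.lookup m i)) *
      (of_rat (Poly_Mapping.lookup Q n) * (\<Prod>i\<in>Poly_Mapping.keys n. x i ^ Poly_Mapping.lookup n i)))"
    by (simp add: eval_rat_mpoly_sum eval_rat_mpoly_single prod_power_lookup_add of_rat_mult algebra_simps)
  then show ?thesis
    unfolding eval_rat_mpoly_def by (simp add: sum_product)
qed

section \<open>Functions given by polynomials with rational coefficients\<close>

text \<open>Closure properties are proved for functions, so that the polynomial behind a determinant
  never has to be written down.\<close>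

definition rat_polyfun :: "'i set \<Rightarrow> (('i \<Rightarrow> real) \<Rightarrow> real) \<Rightarrow> bool" where
  "rat_polyfun I F \<longleftrightarrow>
     (\<exists>P. (\<forall>m\<in>Poly_Mapping.keys P. Poly_Mapping.keys m \<subseteq> I) \<and> (\<forall>x. F x = eval_rat_mpoly x P))"

lemma rat_polyfun_const: "rat_polyfun I (\<lambda>x. of_rat c)"
  unfolding rat_polyfun_def
  by (rule exI[of _ "Poly_Mapping.single 0 c"]) (auto simp: eval_rat_mpoly_single)

lemma rat_polyfun_of_int [intro]: "rat_polyfun I (\<lambda>x. of_int c)"
  using rat_polyfun_const[of I "of_int c"] by simp

lemma rat_polyfun_of_bool [intro]: "rat_polyfun I (\<lambda>x. of_bool b)"
  using rat_polyfun_of_int[of I "of_bool b"] by simp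

lemma rat_polyfun_0 [intro]: "rat_polyfun I (\<lambda>x. 0)"
  using rat_polyfun_of_int[of I 0] by simp

lemma rat_polyfun_1 [intro]: "rat_polyfun I (\<lambda>x. 1)"
  using rat_polyfun_of_int[of I 1] by simp

lemma rat_polyfun_var [intro]:
  assumes "i \<in> I"
  shows "rat_polyfun I (\<lambda>x. x i)"
  unfolding rat_polyfun_def
  by (rule exI[of _ "Poly_Mapping.single (Poly_Mapping.single i 1) 1"])
    (use assms in \<open>auto simp: eval_rat_mpoly_single\<close>)

lemma rat_polyfun_add [intro]:
  assumes "rat_polyfun I F" "rat_polyfun I G"
  shows "rat_polyfun I (\<lambda>x. F x + G x)"
proof -
  obtain P Q where "\<forall>m\<in>Poly_Mapping.keys P. Poly_Mapping.keys m \<subseteq> I" "\<And>x. F x = eval_rat_mpoly x P"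
    "\<forall>m\<in>Poly_Mapping.keys Q. Poly_Mapping.keys m \<subseteq> I" "\<And>x. G x = eval_rat_mpoly x Q"
    using assms unfolding rat_polyfun_def by metis
  then show ?thesis
    unfolding rat_polyfun_def using Poly_Mapping.keys_add[of P Q]
    by (intro exI[of _ "P + Q"]) (simp add: eval_rat_mpoly_add, blast)
qed

lemma rat_polyfun_mult [intro]:
  assumes "rat_polyfun I F" "rat_polyfun I G"
  shows "rat_polyfun I (\<lambda>x. F x * G x)"
proof -
  obtain P Q where PQ: "\<forall>m\<in>Poly_Mapping.keys P. Poly_Mapping.keys m \<subseteq> I" "\<And>x. F x = eval_rat_mpoly x P"
    "\<forall>m\<in>Poly_Mapping.keys Q. Poly_Mapping.keys m \<subseteq> I" "\<And>x. G x = eval_rat_mpoly x Q"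
    using assms unfolding rat_polyfun_def by metis
  have "Poly_Mapping.keys m \<subseteq> I" if m: "m \<in> Poly_Mapping.keys (P * Q)" for m
  proof -
    obtain a b where "m = a + b" "a \<in> Poly_Mapping.keys P" "b \<in> Poly_Mapping.keys Q"
      using m Poly_Mapping.keys_mult[of P Q] by blast
    then show ?thesis
      using PQ Poly_Mapping.keys_add[of a b] by blast
  qed
  then show ?thesis
    unfolding rat_polyfun_def using PQ
    by (intro exI[of _ "P * Q"]) (auto simp: eval_rat_mpoly_mult)
qed

lemma rat_polyfun_diff [intro]:
  assumes "rat_polyfun I F" "rat_polyfun I G"
  shows "rat_polyfun I (\<lambda>x. F x - G x)"
  using rat_polyfun_add[OF assms(1) rat_polyfun_mult[OF rat_polyfun_of_int[of I "-1"] assms(2)]]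
  by simp

lemma rat_polyfun_sum [intro]:
  assumes "\<And>a. a \<in> A \<Longrightarrow> rat_polyfun I (F a)"
  shows "rat_polyfun I (\<lambda>x. \<Sum>a\<in>A. F a x)"
  using assms by (induction A rule: infinite_finite_induct) auto

lemma rat_polyfun_prod [intro]:
  assumes "\<And>a. a \<in> A \<Longrightarrow> rat_polyfun I (F a)"
  shows "rat_polyfun I (\<lambda>x. \<Prod>a\<in>A. F a x)"
  using assms by (induction A rule: infinite_finite_induct) auto

lemma rat_polyfun_det [intro]:
  fixes M :: "('i \<Rightarrow> real) \<Rightarrow> real^'k^'k"
  assumes "\<And>a b. rat_polyfun I (\<lambda>x. M x $ a $ b)"
  shows "rat_polyfun I (\<lambda>x. det (M x))"
  unfolding det_def
  by (intro rat_polyfun_sum rat_polyfun_mult rat_polyfun_of_int rat_polyfun_prod assms)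

text \<open>This is how genericity is used: a single nonzero value, at an arbitrary point, shows
  that the polynomial is not zero, and a generic point is no root of it.\<close>

lemma rat_polyfun_nonzero:
  assumes "rat_polyfun I F" "F x0 \<noteq> 0" "alg_independent_rat I x"
  shows "F x \<noteq> 0"
  using assms unfolding rat_polyfun_def alg_independent_rat_def by (metis eval_rat_mpoly_0)

section \<open>Density of generic points\<close>

lemma alg_independent_rat_mono:
  assumes "alg_independent_rat I x" "J \<subseteq> I"
  shows "alg_independent_rat J x"
  using assms unfolding alg_independent_rat_def by (meson subset_trans)

text \<open>As a polynomial in the variable \<open>i\<close>, \<open>P\<close> has coefficients that
  are polynomials over \<open>I\<close>. One of them is not the zero polynomial, hence does not
  vanish at \<open>x\<close>, and a nonzero univariate polynomial has finitely many roots.\<close>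

lemma finite_roots_last_variable:
  assumes x: "alg_independent_rat I x" and i: "i \<notin> I" and "P \<noteq> 0"
    and P: "\<And>m. m \<in> Poly_Mapping.keys P \<Longrightarrow> Poly_Mapping.keys m \<subseteq> insert i I"
  shows "finite {t. eval_rat_mpoly (x(i := t)) P = 0}"
proof -
  let ?K = "Poly_Mapping.keys P"
  define drop where "drop m = Poly_Mapping.update i (0::nat) m" for m
  define C where "C k = (\<Sum>m\<in>{m\<in>?K. Poly_Mapping.lookup m i = k}.
    Poly_Mapping.single (drop m) (Poly_Mapping.lookup P m))" for k
  have lookup_drop: "Poly_Mapping.lookup (drop m) j = (if j = i then 0 else Poly_Mapping.lookup m j)" for m j
    by (simp add: drop_def lookup_update)
  have keys_drop: "Poly_Mapping.keys (drop m) = Poly_Mapping.keys m - {i}" for m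
    by (auto simp: in_keys_iff lookup_drop split: if_splits)
  define N where "N = Max ((\<lambda>m. Poly_Mapping.lookup m i) ` ?K)"
  have le_N: "Poly_Mapping.lookup m i \<le> N" if "m \<in> ?K" for m
    using that by (simp add: N_def)
  have mon: "(\<Prod>j\<in>Poly_Mapping.keys m. (x(i := t)) j ^ Poly_Mapping.lookup m j) =
      (\<Prod>j\<in>Poly_Mapping.keys (drop m). x j ^ Poly_Mapping.lookup (drop m) j) * t ^ Poly_Mapping.lookup m i" for m t
  proof -
    let ?S = "insert i (Poly_Mapping.keys m)"
    have "(\<Prod>j\<in>Poly_Mapping.keys m. (x(i := t)) j ^ Poly_Mapping.lookup m j) =
        (\<Prod>j\<in>?S. (x(i := t)) j ^ Poly_Mapping.lookup m j)"
      by (rule prod_power_lookup_superset) auto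
    also have "\<dots> = t ^ Poly_Mapping.lookup m i *
        (\<Prod>j\<in>Poly_Mapping.keys m - {i}. (x(i := t)) j ^ Poly_Mapping.lookup m j)"
      by (subst prod.insert_remove) auto
    also have "(\<Prod>j\<in>Poly_Mapping.keys m - {i}. (x(i := t)) j ^ Poly_Mapping.lookup m j) =
        (\<Prod>j\<in>Poly_Mapping.keys (drop m). x j ^ Poly_Mapping.lookup (drop m) j)"
      by (rule prod.cong) (auto simp: keys_drop lookup_drop)
    finally show ?thesis
      by (simp add: mult.commute)
  qed
  have eq: "eval_rat_mpoly (x(i := t)) P = (\<Sum>k\<le>N. eval_rat_mpoly x (C k) * t ^ k)" for t
  proof -
    have "eval_rat_mpoly (x(i := t)) P = (\<Sum>m\<in>?K. of_rat (Poly_Mapping.lookup P m) *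
        (\<Prod>j\<in>Poly_Mapping.keys (drop m). x j ^ Poly_Mapping.lookup (drop m) j) * t ^ Poly_Mapping.lookup m i)"
      unfolding eval_rat_mpoly_def mon by (simp add: mult.assoc)
    also have "\<dots> = (\<Sum>k\<le>N. \<Sum>m\<in>{m\<in>?K. Poly_Mapping.lookup m i = k}. of_rat (Poly_Mapping.lookup P m) *
        (\<Prod>j\<in>Poly_Mapping.keys (drop m). x j ^ Poly_Mapping.lookup (drop m) j) * t ^ Poly_Mapping.lookup m i)"
      by (rule sum.group[symmetric]) (auto simp: le_N)
    also have "\<dots> = (\<Sum>k\<le>N. eval_rat_mpoly x (C k) * t ^ k)"
      unfolding C_def eval_rat_mpoly_sum eval_rat_mpoly_single sum_distrib_right
      by (intro sum.cong refl) auto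
    finally show ?thesis .
  qed
  obtain m0 where m0: "m0 \<in> ?K"
    using \<open>P \<noteq> 0\<close> by (metis all_not_in_conv keys_eq_empty)
  let ?k = "Poly_Mapping.lookup m0 i"
  \<comment> \<open>The exponent at \<open>i\<close> and the remaining exponents determine a
    monomial, so no two terms of \<open>P\<close> merge or cancel in \<open>C ?k\<close>.\<close>
  have inj: "m = m0" if "drop m = drop m0" "Poly_Mapping.lookup m i = ?k" for m
    using that by (metis lookup_drop poly_mapping_eqI)
  have "Poly_Mapping.lookup (C ?k) (drop m0) =
      (\<Sum>m\<in>{m\<in>?K. Poly_Mapping.lookup m i = ?k}. if m = m0 then Poly_Mapping.lookup P m else 0)"
    unfolding C_def lookup_sum
    by (intro sum.cong refl) (auto simp: lookup_single when_def dest: inj)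
  also have "\<dots> = Poly_Mapping.lookup P m0"
    using m0 by (subst sum.delta) auto
  also have "\<dots> \<noteq> 0"
    using m0 by (simp add: in_keys_iff)
  finally have "C ?k \<noteq> 0"
    by auto
  moreover have "Poly_Mapping.keys m \<subseteq> I" if "m \<in> Poly_Mapping.keys (C k)" for m k
  proof -
    have "Poly_Mapping.keys (C k) \<subseteq> (\<Union>m\<in>{m\<in>?K. Poly_Mapping.lookup m i = k}.
        Poly_Mapping.keys (Poly_Mapping.single (drop m) (Poly_Mapping.lookup P m)))"
      unfolding C_def by (rule keys_sum)
    then have "m \<in> drop ` ?K"
      using that by (fastforce split: if_splits)
    then show ?thesis
      using P keys_drop by fastforce
  qed
  ultimately have "eval_rat_mpoly x (C ?k) \<noteq> 0"
    using x unfolding alg_independent_rat_def by blast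
  then show ?thesis
    unfolding eq polyfun_finite_roots using le_N[OF m0] by blast
qed

text \<open>Monomials are encoded by exponent functions on the finite set \<open>I\<close>, and
  polynomials by finite sets of pairs of monomial and coefficient.\<close>

lemma countable_finite_support_mpoly:
  assumes "finite (I :: 'i set)"
  shows "countable {P :: ('i \<Rightarrow>\<^sub>0 nat) \<Rightarrow>\<^sub>0 rat. \<forall>m\<in>Poly_Mapping.keys P. Poly_Mapping.keys m \<subseteq> I}"
    (is "countable ?Ps")
proof -
  let ?M = "{m :: 'i \<Rightarrow>\<^sub>0 nat. Poly_Mapping.keys m \<subseteq> I}"
  have "inj_on (\<lambda>m. restrict (Poly_Mapping.lookup m) I) ?M"
  proof (rule inj_onI)
    fix m n :: "'i \<Rightarrow>\<^sub>0 nat"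
    assume *: "m \<in> ?M" "n \<in> ?M" "restrict (Poly_Mapping.lookup m) I = restrict (Poly_Mapping.lookup n) I"
    show "m = n"
    proof (rule poly_mapping_eqI)
      fix i
      show "Poly_Mapping.lookup m i = Poly_Mapping.lookup n i"
      proof (cases "i \<in> I")
        case True
        then show ?thesis using *(3) by (metis restrict_apply')
      next
        case False
        then have "i \<notin> Poly_Mapping.keys m" "i \<notin> Poly_Mapping.keys n" using * by auto
        then show ?thesis by (simp add: in_keys_iff)
      qed
    qed
  qed
  moreover have "countable ((\<lambda>m. restrict (Poly_Mapping.lookup m) I) ` ?M)"
    by (rule countable_subset[OF _ countable_PiE[of I "\<lambda>_. UNIV :: nat set"]]) (use assms in auto)
  ultimately have M: "countable ?M"
    using countable_image_inj_on by blast
  let ?f = "\<lambda>P :: ('i \<Rightarrow>\<^sub>0 nat) \<Rightarrow>\<^sub>0 rat. (\<lambda>m. (m, Poly_Mapping.lookup P m)) ` Poly_Mapping.keys P"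
  have "inj_on ?f ?Ps"
  proof (rule inj_onI)
    fix P Q :: "('i \<Rightarrow>\<^sub>0 nat) \<Rightarrow>\<^sub>0 rat"
    assume eq: "?f P = ?f Q"
    show "P = Q"
    proof (rule poly_mapping_eqI)
      fix m
      have "(m, c) \<in> ?f R \<longleftrightarrow> c \<noteq> 0 \<and> Poly_Mapping.lookup R m = c" for c R
        by (auto simp: in_keys_iff)
      then show "Poly_Mapping.lookup P m = Poly_Mapping.lookup Q m"
        using eq by metis
    qed
  qed
  moreover have "countable (?f ` ?Ps)"
    by (rule countable_subset[OF _ countable_Collect_finite_subset[of "?M \<times> UNIV"]])
      (use M in \<open>auto intro!: countable_SIGMA\<close>)
  ultimately show ?thesis
    using countable_image_inj_on by blast
qed

text \<open>Coordinates are chosen one at a time. Each choice must avoid the finitely many roots of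
  each of countably many polynomials, and a countable set cannot cover an interval.\<close>

lemma alg_independent_rat_dense:
  assumes "finite I" "\<epsilon> > 0"
  shows "\<exists>x. alg_independent_rat I x \<and> (\<forall>i\<in>I. \<bar>x i - x0 i\<bar> < \<epsilon>)"
  using assms(1)
proof induction
  case empty
  have "P = 0" if "\<forall>m\<in>Poly_Mapping.keys P. Poly_Mapping.keys m \<subseteq> {}" "eval_rat_mpoly x0 P = 0"
    for P :: "('a \<Rightarrow>\<^sub>0 nat) \<Rightarrow>\<^sub>0 rat"
  proof -
    have "Poly_Mapping.keys P \<subseteq> {0}"
      using that by auto
    then have "eval_rat_mpoly x0 P = of_rat (Poly_Mapping.lookup P 0)"
      by (simp add: eval_rat_mpoly_superset[of "{0}"])
    with that have "Poly_Mapping.lookup P 0 = 0" by simp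
    with \<open>Poly_Mapping.keys P \<subseteq> {0}\<close> show ?thesis
      by (metis keys_eq_empty in_keys_iff subset_singletonD insertI1)
  qed
  then show ?case
    by (auto simp: alg_independent_rat_def)
next
  case (insert i I)
  then obtain x where x: "alg_independent_rat I x" "\<forall>j\<in>I. \<bar>x j - x0 j\<bar> < \<epsilon>"
    by auto
  let ?Ps = "{P :: ('a \<Rightarrow>\<^sub>0 nat) \<Rightarrow>\<^sub>0 rat. \<forall>m\<in>Poly_Mapping.keys P. Poly_Mapping.keys m \<subseteq> insert i I} - {0}"
  let ?bad = "\<Union>P\<in>?Ps. {t. eval_rat_mpoly (x(i := t)) P = 0}"
  have "countable ?Ps"
    by (rule countable_subset[OF Diff_subset countable_finite_support_mpoly]) (use insert.hyps in simp)
  moreover have "countable {t. eval_rat_mpoly (x(i := t)) P = 0}" if "P \<in> ?Ps" for P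
    by (rule countable_finite, rule finite_roots_last_variable[OF x(1) insert.hyps(2)]) (use that in blast)+
  ultimately have "countable ?bad"
    by (rule countable_UN)
  moreover have "uncountable {x0 i - \<epsilon> <..< x0 i + \<epsilon>}"
    using \<open>\<epsilon> > 0\<close> by (simp add: uncountable_open_interval)
  ultimately have "\<not> {x0 i - \<epsilon> <..< x0 i + \<epsilon>} \<subseteq> ?bad"
    by (metis (no_types, lifting) countable_subset)
  then obtain t where t: "t \<in> {x0 i - \<epsilon> <..< x0 i + \<epsilon>}" "t \<notin> ?bad"
    by blast
  have "alg_independent_rat (insert i I) (x(i := t))"
    using t(2) unfolding alg_independent_rat_def by blast
  moreover have "\<forall>j\<in>insert i I. \<bar>(x(i := t)) j - x0 j\<bar> < \<epsilon>"
    using x(2) t(1) insert.hyps by auto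
  ultimately show ?case by blast
qed

subsection \<open>Infinitesimal rigidity\<close>

text \<open>A matrix and its Gram matrix have the same kernel. The determinant thus turns
  injectivity of a rectangular matrix into nonvanishing of one polynomial.\<close>

lemma det_gram_nonzero_iff:
  fixes M :: "real^'k^'m"
  shows "det (transpose M ** M) \<noteq> 0 \<longleftrightarrow> (\<forall>v. M *v v = 0 \<longrightarrow> v = 0)"
proof
  assume "det (transpose M ** M) \<noteq> 0"
  then have "invertible (transpose M ** M)"
    by (simp add: invertible_det_nz)
  then have "\<forall>v. (transpose M ** M) *v v = 0 \<longrightarrow> v = 0"
    using matrix_left_invertible_ker invertible_left_inverse by blast
  then show "\<forall>v. M *v v = 0 \<longrightarrow> v = 0"
    by (simp flip: matrix_vector_mul_assoc)
next
  assume M: "\<forall>v. M *v v = 0 \<longrightarrow> v = 0"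
  have "v = 0" if "(transpose M ** M) *v v = 0" for v
  proof -
    have "(M *v v) \<bullet> (M *v v) = v \<bullet> ((transpose M ** M) *v v)"
      by (metis dot_lmul_matrix matrix_vector_mul_assoc transpose_transpose vector_transpose_matrix)
    then show ?thesis
      using M that by simp
  qed
  then have "invertible (transpose M ** M)"
    using matrix_left_invertible_ker invertible_left_inverse by blast
  then show "det (transpose M ** M) \<noteq> 0"
    by (simp add: invertible_det_nz)
qed

text \<open>The pins \<open>B\<close> take the place of factoring out Euclidean motions, so that
  rigidity is triviality of a kernel. Configurations are vectors over a finite type, which provides
  topology and matrices.\<close>

definition inf_rigid :: "'v set \<Rightarrow> ('v \<times> 'v) set \<Rightarrow> (real^'n)^'v \<Rightarrow> bool" where
  "inf_rigid B E c \<longleftrightarrow>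
     (\<forall>d :: (real^'n)^'v. (\<forall>v\<in>B. d $ v = 0) \<longrightarrow>
        (\<forall>(u, w)\<in>E. (c $ u - c $ w) \<bullet> (d $ u - d $ w) = 0) \<longrightarrow> d = 0)"

text \<open>The kernel consists of the infinitesimal flexes that fix \<open>B\<close>. Rows are
  indexed by whole types; those outside \<open>B\<close> and \<open>E\<close> are zero.\<close>

definition rigidity_matrix ::
    "'v::finite set \<Rightarrow> ('v \<times> 'v) set \<Rightarrow> (real^'n::finite)^'v \<Rightarrow> real^('v \<times> 'n)^(('v \<times> 'n) + ('v \<times> 'v))" where
  "rigidity_matrix B E c = (\<chi> r s. case r of
       Inl t \<Rightarrow> of_bool (t = s \<and> fst t \<in> B)
     | Inr (u, w) \<Rightarrow> of_bool ((u, w) \<in> E) * (of_bool (fst s = u) - of_bool (fst s = w)) *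
         (c $ u $ snd s - c $ w $ snd s))"

lemma rigidity_matrix_mult_Inl:
  "(rigidity_matrix B E c *v x) $ Inl t = (if fst t \<in> B then x $ t else 0)"
  by (cases "fst t \<in> B")
    (simp_all add: matrix_vector_mult_def rigidity_matrix_def of_bool_def if_distrib[where f="\<lambda>y. y * _"] cong: if_cong)

lemma rigidity_matrix_mult_Inr:
  assumes "(u, w) \<in> E"
  shows "(rigidity_matrix B E c *v (\<chi> s. d $ fst s $ snd s)) $ Inr (u, w) =
    (c $ u - c $ w) \<bullet> (d $ u - d $ w)"
proof -
  have "(rigidity_matrix B E c *v (\<chi> s. d $ fst s $ snd s)) $ Inr (u, w) =
      (\<Sum>v\<in>UNIV. \<Sum>k\<in>UNIV. (of_bool (v = u) - of_bool (v = w)) *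
        ((c $ u $ k - c $ w $ k) * d $ v $ k))"
    using assms
    by (simp add: matrix_vector_mult_def rigidity_matrix_def sum.cartesian_product case_prod_beta mult.assoc
        flip: UNIV_Times_UNIV)
  also have "\<dots> = (\<Sum>v\<in>UNIV. (of_bool (v = u) - of_bool (v = w)) *
        ((c $ u - c $ w) \<bullet> d $ v))"
    by (simp add: inner_vec_def sum_distrib_left)
  also have "\<dots> = (\<Sum>v\<in>UNIV. (if v = u then (c $ u - c $ w) \<bullet> d $ v else 0) -
        (if v = w then (c $ u - c $ w) \<bullet> d $ v else 0))"
    by (intro sum.cong refl) auto
  also have "\<dots> = (c $ u - c $ w) \<bullet> (d $ u - d $ w)"
    by (simp add: sum_subtractf inner_diff_right)
  finally show ?thesis .
qed

text \<open>Infinitesimal rigidity becomes nonvanishing of a polynomial in the coordinates. This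
  makes it an open condition, and one that passes from any position to all generic ones.\<close>

lemma inf_rigid_iff_det:
  fixes c :: "(real^'n::finite)^'v::finite"
  shows "inf_rigid B E c \<longleftrightarrow>
     det (transpose (rigidity_matrix B E c) ** rigidity_matrix B E c) \<noteq> 0"
  unfolding det_gram_nonzero_iff
proof
  assume inf: "inf_rigid B E c"
  show "\<forall>x. rigidity_matrix B E c *v x = 0 \<longrightarrow> x = 0"
  proof (intro allI impI)
    fix x assume x: "rigidity_matrix B E c *v x = 0"
    define d :: "(real^'n)^'v" where "d = (\<chi> v k. x $ (v, k))"
    have x_d: "x = (\<chi> s. d $ fst s $ snd s)"
      by (simp add: d_def vec_eq_iff)
    have "d $ v = 0" if "v \<in> B" for v
    proof -
      have "x $ (v, k) = 0" for k
        using rigidity_matrix_mult_Inl[of B E c x "(v, k)"] x that by simp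
      then show ?thesis
        by (simp add: d_def vec_eq_iff)
    qed
    moreover have "(c $ u - c $ w) \<bullet> (d $ u - d $ w) = 0" if "(u, w) \<in> E" for u w
      using rigidity_matrix_mult_Inr[OF that, of B c d] x x_d by simp
    ultimately have "d = 0"
      using inf unfolding inf_rigid_def by blast
    then show "x = 0"
      by (simp add: x_d vec_eq_iff)
  qed
next
  assume ker: "\<forall>x. rigidity_matrix B E c *v x = 0 \<longrightarrow> x = 0"
  show "inf_rigid B E c"
    unfolding inf_rigid_def
  proof (intro allI impI)
    fix d :: "(real^'n)^'v"
    assume B: "\<forall>v\<in>B. d $ v = 0"
      and E: "\<forall>(u, w)\<in>E. (c $ u - c $ w) \<bullet> (d $ u - d $ w) = 0"
    let ?x = "\<chi> s. d $ fst s $ snd s"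
    have "(rigidity_matrix B E c *v ?x) $ r = 0" for r
    proof (cases r)
      case (Inl t)
      then show ?thesis using B by (simp add: rigidity_matrix_mult_Inl)
    next
      case (Inr e)
      obtain u w where e: "e = (u, w)" by fastforce
      show ?thesis
      proof (cases "(u, w) \<in> E")
        case True
        then show ?thesis using E Inr e by (auto simp: rigidity_matrix_mult_Inr)
      next
        case False
        then show ?thesis using Inr e by (simp add: matrix_vector_mult_def rigidity_matrix_def)
      qed
    qed
    then have "rigidity_matrix B E c *v ?x = 0"
      by (simp only: vec_eq_iff zero_index) simp
    then have "?x = 0"
      using ker by blast
    then show "d = 0"
      by (simp add: vec_eq_iff)
  qed
qed

text \<open>Two vectors have equal length exactly if their sum and difference are orthogonal, which
  links equivalent configurations to infinitesimal flexes.\<close>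

lemma inner_add_diff:
  fixes a b :: "'a::real_inner"
  shows "(a + b) \<bullet> (a - b) = (norm a)\<^sup>2 - (norm b)\<^sup>2"
  unfolding power2_norm_eq_inner inner_add_left inner_diff_right by (simp add: inner_commute)

lemma open_inf_rigid:
  fixes B :: "'v::finite set"
  shows "open {c :: (real^'n::finite)^'v. inf_rigid B E c}"
proof -
  have entry: "continuous_on UNIV (\<lambda>c. rigidity_matrix B E (c :: (real^'n)^'v) $ r $ s)" for r s
    unfolding rigidity_matrix_def
    by (cases r) (simp_all add: case_prod_beta continuous_intros)
  have "continuous_on UNIV (\<lambda>c :: (real^'n)^'v.
      det (transpose (rigidity_matrix B E c) ** rigidity_matrix B E c))"
    unfolding det_def matrix_matrix_mult_def transpose_def
    by (simp, intro continuous_intros entry)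
  then have "open ((\<lambda>c :: (real^'n)^'v.
      det (transpose (rigidity_matrix B E c) ** rigidity_matrix B E c)) -` (- {0}))"
    by (rule open_vimage[rotated]) auto
  then show ?thesis
    by (simp add: inf_rigid_iff_det vimage_def)
qed

lemma inf_rigid_generic:
  fixes \<phi> :: "'v::finite \<Rightarrow> 'a" and p :: "'a \<Rightarrow> real^'n" and c\<^sub>0 :: "(real^'n::finite)^'v"
  assumes "inf_rigid B E c\<^sub>0" "inj \<phi>" "range \<phi> \<subseteq> V"
    and "alg_independent_rat (V \<times> UNIV) (\<lambda>(v, k). p v $ k)"
  shows "inf_rigid B E (\<chi> v. p (\<phi> v))"
proof -
  define c :: "('a \<times> 'n \<Rightarrow> real) \<Rightarrow> (real^'n)^'v" where "c x = (\<chi> v k. x (\<phi> v, k))" for x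
  define F where "F x = det (transpose (rigidity_matrix B E (c x)) ** rigidity_matrix B E (c x))" for x
  have entry: "rat_polyfun (V \<times> UNIV) (\<lambda>x. rigidity_matrix B E (c x) $ r $ s)" for r s
    using assms(3)
    by (cases r) (auto simp: rigidity_matrix_def c_def case_prod_beta range_subsetD simp del: of_bool_eq_iff
        intro!: rat_polyfun_mult rat_polyfun_diff rat_polyfun_var rat_polyfun_of_bool)
  have "rat_polyfun (V \<times> UNIV) F"
    unfolding F_def
    by (rule rat_polyfun_det)
      (simp add: matrix_matrix_mult_def transpose_def, intro rat_polyfun_sum rat_polyfun_mult entry)
  moreover have "F (\<lambda>(a, k). c\<^sub>0 $ inv \<phi> a $ k) \<noteq> 0"
  proof -
    have "c (\<lambda>(a, k). c\<^sub>0 $ inv \<phi> a $ k) = c\<^sub>0"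
      using \<open>inj \<phi>\<close> by (simp add: c_def vec_eq_iff)
    then show ?thesis
      using assms(1) by (simp add: F_def inf_rigid_iff_det)
  qed
  ultimately have "F (\<lambda>(v, k). p v $ k) \<noteq> 0"
    using rat_polyfun_nonzero assms(4) by blast
  then show ?thesis
    by (simp add: F_def c_def inf_rigid_iff_det)
qed

text \<open>The displacement between two equivalent configurations is an infinitesimal flex of their midpoint.\<close>

lemma inf_rigid_isolated:
  fixes p :: "(real^'n::finite)^'v::finite"
  assumes "inf_rigid B E p"
  shows "\<exists>r>0. \<forall>q. dist q p < r \<longrightarrow> (\<forall>v\<in>B. q $ v = p $ v) \<longrightarrow>
    (\<forall>(u, w)\<in>E. norm (q $ u - q $ w) = norm (p $ u - p $ w)) \<longrightarrow> q = p"
proof -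
  obtain r where r: "r > 0" "\<And>c. dist c p < r \<Longrightarrow> inf_rigid B E c"
    using open_inf_rigid[of B E] assms unfolding open_dist by blast
  have "q = p" if q: "dist q p < r" "\<forall>v\<in>B. q $ v = p $ v"
    "\<forall>(u, w)\<in>E. norm (q $ u - q $ w) = norm (p $ u - p $ w)" for q
  proof -
    have "dist (midpoint q p) p < r"
      using q(1) dist_midpoint(4)[of q p] \<open>r > 0\<close> zero_le_dist[of q p] by linarith
    then have "inf_rigid B E (midpoint q p)"
      by (rule r(2))
    moreover have "(midpoint q p $ u - midpoint q p $ w) \<bullet> ((q - p) $ u - (q - p) $ w) = 0"
      if "(u, w) \<in> E" for u w
    proof -
      have "midpoint q p $ u - midpoint q p $ w = (1/2) *\<^sub>R ((q $ u - q $ w) + (p $ u - p $ w))"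
        by (simp add: midpoint_def algebra_simps)
      moreover have "(q - p) $ u - (q - p) $ w = (q $ u - q $ w) - (p $ u - p $ w)"
        by simp
      moreover have "((q $ u - q $ w) + (p $ u - p $ w)) \<bullet> ((q $ u - q $ w) - (p $ u - p $ w)) =
          (norm (q $ u - q $ w))\<^sup>2 - (norm (p $ u - p $ w))\<^sup>2"
        by (rule inner_add_diff)
      moreover have "norm (q $ u - q $ w) = norm (p $ u - p $ w)"
        using q(3) that by blast
      ultimately show ?thesis
        by (metis diff_self inner_scaleR_left mult_zero_right)
    qed
    moreover have "\<forall>v\<in>B. (q - p) $ v = 0"
      using q(2) by simp
    ultimately have "q - p = 0"
      unfolding inf_rigid_def by blast
    then show ?thesis by simp
  qed
  then show ?thesis
    using r(1) by blast
qed

text \<open>The parameter \<open>u\<close> together with the residuals is a map between spaces of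
  equal dimension with injective, hence invertible, derivative at the base point. Sussmann's open
  mapping theorem then gives a neighbourhood of its value in the image.\<close>

lemma implicit_solution_nearby:
  fixes E :: "'k \<Rightarrow> 'u::euclidean_space \<times> 'v::euclidean_space \<Rightarrow> real"
  assumes K: "finite K" "card K = DIM('v)"
    and cont: "\<And>k. k \<in> K \<Longrightarrow> continuous_on UNIV (E k)"
    and der: "\<And>k. k \<in> K \<Longrightarrow> (E k has_derivative E' k) (at (u\<^sub>0, v\<^sub>0))"
    and zero: "\<And>k. k \<in> K \<Longrightarrow> E k (u\<^sub>0, v\<^sub>0) = 0"
    and inj: "\<And>v. (\<And>k. k \<in> K \<Longrightarrow> E' k (0, v) = 0) \<Longrightarrow> v = 0"
    and "\<epsilon> > 0"
  shows "\<exists>\<delta>>0. \<forall>u. dist u u\<^sub>0 < \<delta> \<longrightarrow> (\<exists>v. dist v v\<^sub>0 < \<epsilon> \<and> (\<forall>k\<in>K. E k (u, v) = 0))"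
proof -
  obtain \<beta> :: "'k \<Rightarrow> 'v" where \<beta>: "bij_betw \<beta> K Basis"
    using K by (metis finite_Basis finite_same_card_bij)
  have comp: "(\<Sum>k\<in>K. a k *\<^sub>R \<beta> k) \<bullet> \<beta> j = a j" if "j \<in> K" for a j
  proof -
    have "(\<Sum>k\<in>K. a k *\<^sub>R \<beta> k) \<bullet> \<beta> j = (\<Sum>k\<in>K. if k = j then a k else 0)"
      unfolding inner_sum_left
    proof (intro sum.cong refl)
      fix k assume "k \<in> K"
      have "\<beta> k \<in> Basis" "\<beta> j \<in> Basis" "\<beta> k = \<beta> j \<longleftrightarrow> k = j"
        using \<beta> that \<open>k \<in> K\<close> by (auto simp: bij_betw_def inj_on_def)
      then show "(a k *\<^sub>R \<beta> k) \<bullet> \<beta> j = (if k = j then a k else 0)"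
        by (simp add: inner_Basis)
    qed
    then show ?thesis using that K by simp
  qed
  define G where "G x = (fst x, \<Sum>k\<in>K. E k x *\<^sub>R \<beta> k)" for x :: "'u \<times> 'v"
  define G' where "G' x = (fst x, \<Sum>k\<in>K. E' k x *\<^sub>R \<beta> k)" for x :: "'u \<times> 'v"
  have derG: "(G has_derivative G') (at (u\<^sub>0, v\<^sub>0))"
    unfolding G_def G'_def by (intro derivative_intros der) auto
  have contG: "continuous_on UNIV G"
    unfolding G_def by (intro continuous_intros cont) auto
  have lin: "linear G'"
    using derG by (rule has_derivative_linear)
  have "x = 0" if "G' x = 0" for x
  proof -
    have 1: "fst x = 0" and 2: "(\<Sum>k\<in>K. E' k x *\<^sub>R \<beta> k) = 0"
      using that by (auto simp: G'_def zero_prod_def)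
    have "E' k (0, snd x) = 0" if "k \<in> K" for k
      using comp[OF that, of "\<lambda>k. E' k x"] 1 2 by (metis inner_zero_left prod.collapse)
    then have "snd x = 0" by (rule inj)
    with 1 show ?thesis by (simp add: prod_eq_iff)
  qed
  then have "inj G'"
    using lin linear_injective_0 by blast
  then obtain g' where g': "linear g'" "\<And>x. G' (g' x) = x"
    using linear_injective_isomorphism[OF lin] by auto
  have "G (u\<^sub>0, v\<^sub>0) \<in> interior (G ` ball (u\<^sub>0, v\<^sub>0) \<epsilon>)"
    by (rule sussmann_open_mapping[OF open_UNIV contG _ derG, of g'])
      (use g' \<open>\<epsilon> > 0\<close> in \<open>auto simp: linear_conv_bounded_linear interior_open\<close>)
  then obtain \<delta> where \<delta>: "\<delta> > 0" "ball (G (u\<^sub>0, v\<^sub>0)) \<delta> \<subseteq> G ` ball (u\<^sub>0, v\<^sub>0) \<epsilon>"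
    using mem_interior by blast
  have "\<exists>v. dist v v\<^sub>0 < \<epsilon> \<and> (\<forall>k\<in>K. E k (u, v) = 0)" if "dist u u\<^sub>0 < \<delta>" for u
  proof -
    have "G (u\<^sub>0, v\<^sub>0) = (u\<^sub>0, 0)"
      by (simp add: G_def zero)
    then have "(u, 0) \<in> ball (G (u\<^sub>0, v\<^sub>0)) \<delta>"
      using that by (simp add: dist_Pair_Pair dist_commute)
    then obtain x where x: "x \<in> ball (u\<^sub>0, v\<^sub>0) \<epsilon>" "G x = (u, 0)"
      using \<delta>(2) by (metis imageE subsetD)
    have fx: "fst x = u" and sx: "(\<Sum>k\<in>K. E k x *\<^sub>R \<beta> k) = 0"
      using x(2) by (auto simp: G_def)
    have "E k (u, snd x) = 0" if "k \<in> K" for k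
      using comp[OF that, of "\<lambda>k. E k x"] sx fx by (metis inner_zero_left prod.collapse)
    moreover have "dist (snd x) v\<^sub>0 < \<epsilon>"
      using x(1) dist_snd_le[of "(u\<^sub>0, v\<^sub>0)" x] by (simp add: dist_commute)
    ultimately show ?thesis by blast
  qed
  then show ?thesis
    using \<delta>(1) by blast
qed

subsection \<open>A special position of the chain\<close>

datatype chain_vertex = A0 | A1 | X0 | X1 | X2 | Y0 | Y1 | Y2 | Y3 | Y4 | B0 | B1 | B2 | B3

lemma UNIV_chain_vertex: "UNIV = {A0, A1, X0, X1, X2, Y0, Y1, Y2, Y3, Y4, B0, B1, B2, B3}"
  by (auto intro: chain_vertex.exhaust)

instance chain_vertex :: finite
  by standard (simp add: UNIV_chain_vertex)

definition part1 :: "chain_vertex set" where "part1 = {A0, A1}"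
definition part2 :: "chain_vertex set" where "part2 = {X0, X1, X2}"
definition part3 :: "chain_vertex set" where "part3 = {Y0, Y1, Y2, Y3, Y4}"
definition part4 :: "chain_vertex set" where "part4 = {B0, B1, B2, B3}"

lemmas parts_def = part1_def part2_def part3_def part4_def

definition chain_pairs :: "(chain_vertex \<times> chain_vertex) set" where
  "chain_pairs = part2 \<times> part1 \<union> part2 \<times> part3 \<union> part4 \<times> part3"

lemma UNIV_5: "UNIV = {1, 2, 3, 4, 5 :: 5}"
proof -
  have "x = 1 \<or> x = 2 \<or> x = 3 \<or> x = 4 \<or> x = 5" for x :: 5
  proof (induct x)
    case (of_int z)
    then have "z = 0 \<or> z = 1 \<or> z = 2 \<or> z = 3 \<or> z = 4" by fastforce
    then show ?case by auto
  qed
  then show ?thesis by auto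
qed

lemma sum_5: "sum f (UNIV :: 5 set) = f 1 + f 2 + f 3 + f 4 + f 5"
  unfolding UNIV_5 by (simp add: ac_simps)

lemma forall_5: "(\<forall>i :: 5. P i) \<longleftrightarrow> P 1 \<and> P 2 \<and> P 3 \<and> P 4 \<and> P 5"
  using UNIV_5 by (metis UNIV_I insertE singletonD)

definition vec5 :: "real \<Rightarrow> real \<Rightarrow> real \<Rightarrow> real \<Rightarrow> real \<Rightarrow> real^5" where
  "vec5 a b c d e = (\<chi> i. if i = 1 then a else if i = 2 then b else if i = 3 then c else if i = 4 then d else e)"

lemma vec5_component [simp]:
  "vec5 a b c d e $ 1 = a" "vec5 a b c d e $ 2 = b" "vec5 a b c d e $ 3 = c"
  "vec5 a b c d e $ 4 = d" "vec5 a b c d e $ 5 = e"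
  by (simp_all add: vec5_def)

lemma inner_5: "x \<bullet> y = x$1 * y$1 + x$2 * y$2 + x$3 * y$3 + x$4 * y$4 + x$5 * y$5"
  for x y :: "real^5"
  by (simp add: inner_vec_def sum_5)

text \<open>In the plane of the first and the fourth coordinate, all points lie on the two axes for \<open>\<sigma> = 0\<close>.
  The parameter shears the points of \<^term>\<open>part1 \<union> part3\<close> and those of \<^term>\<open>part2 \<union> part4\<close> along different
  axes, such that the lengths between the two classes depend on \<open>\<sigma>\<^sup>2\<close> only.\<close>

primrec chain_position :: "real \<Rightarrow> chain_vertex \<Rightarrow> real^5" where
  "chain_position \<sigma> A0 = vec5 0 1 0 1 0"
| "chain_position \<sigma> A1 = vec5 0 0 0 0 1"
| "chain_position \<sigma> X0 = vec5 (-1) (-1) 1 0 (-1)"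
| "chain_position \<sigma> X1 = vec5 \<sigma> 0 0 (-1) 0"
| "chain_position \<sigma> X2 = vec5 \<sigma> 0 0 (-1) 1"
| "chain_position \<sigma> Y0 = vec5 0 0 0 0 (-1)"
| "chain_position \<sigma> Y1 = vec5 0 0 1 (-1) 0"
| "chain_position \<sigma> Y2 = vec5 0 (-1) 0 0 1"
| "chain_position \<sigma> Y3 = vec5 1 0 0 \<sigma> 0"
| "chain_position \<sigma> Y4 = vec5 (-1) 0 (-1) (-\<sigma>) 0"
| "chain_position \<sigma> B0 = vec5 0 0 0 0 0"
| "chain_position \<sigma> B1 = vec5 1 0 0 0 0"
| "chain_position \<sigma> B2 = vec5 0 1 0 0 0"
| "chain_position \<sigma> B3 = vec5 0 0 1 0 0"

definition chain_conf :: "real \<Rightarrow> (real^5)^chain_vertex" where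
  "chain_conf \<sigma> = (\<chi> v. chain_position \<sigma> v)"

text \<open>One affine dependency for \<open>part1\<close> with \<open>part3\<close> and one for
  \<open>part2\<close> with \<open>part4\<close>, both without zero coefficients.\<close>

primrec chain_dependency :: "chain_vertex \<Rightarrow> real" where
  "chain_dependency A0 = 1" | "chain_dependency A1 = -3"
| "chain_dependency X0 = 1" | "chain_dependency X1 = -1" | "chain_dependency X2 = 1"
| "chain_dependency Y0 = -2" | "chain_dependency Y1 = 1" | "chain_dependency Y2 = 1"
| "chain_dependency Y3 = 1" | "chain_dependency Y4 = 1"
| "chain_dependency B0 = -2" | "chain_dependency B1 = 1" | "chain_dependency B2 = 1" | "chain_dependency B3 = -1"

lemma chain_dependency_nonzero: "chain_dependency v \<noteq> 0"
  by (cases v) auto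

lemma chain_dependency_sum:
  "(\<Sum>z\<in>part1 \<union> part3. chain_dependency z) = 0" "(\<Sum>w\<in>part2 \<union> part4. chain_dependency w) = 0"
  by (simp_all add: parts_def)

text \<open>On each class the parameter acts by a linear shear, which preserves linear relations;
  hence the coefficients do not depend on \<sigma>.\<close>

lemma chain_dependency_affine:
  "(\<Sum>z\<in>part1 \<union> part3. chain_dependency z *\<^sub>R chain_conf \<sigma> $ z) = 0"
  "(\<Sum>w\<in>part2 \<union> part4. chain_dependency w *\<^sub>R chain_conf \<sigma> $ w) = 0"
  by (simp_all add: parts_def chain_conf_def vec_eq_iff forall_5)

text \<open>In the plane of the first and fourth coordinates let the points for \<sigma> = 0 be (a,
  b) and (c, d). The sheared difference is (a - \<sigma> b - c, b - d - \<sigma> c), and the linear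
  term of its squared norm is -2 \<sigma> (ab - cd). It vanishes since both points lie on the
  axes.\<close>

lemma chain_conf_equivalent:
  assumes "(w, z) \<in> chain_pairs"
  shows "norm (chain_conf (-\<sigma>) $ w - chain_conf (-\<sigma>) $ z) = norm (chain_conf \<sigma> $ w - chain_conf \<sigma> $ z)"
  using assms unfolding chain_pairs_def parts_def chain_conf_def norm_eq inner_5
  by (auto simp: algebra_simps)

text \<open>With \<open>B0\<close> as the only unpinned vertex, infinitesimal rigidity says that the differences to
  \<open>B0\<close> span the space.\<close>

lemma chain_conf_span:
  "inf_rigid (- {B0}) ((\<lambda>v. (v, B0)) ` (part1 \<union> part4)) (chain_conf \<sigma>)"
  unfolding inf_rigid_def
proof (intro allI impI)
  fix d :: "(real^5)^chain_vertex"
  assume 1: "\<forall>v\<in>- {B0}. d $ v = 0"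
    and 2: "\<forall>(u, w)\<in>(\<lambda>v. (v, B0)) ` (part1 \<union> part4).
      (chain_conf \<sigma> $ u - chain_conf \<sigma> $ w) \<bullet> (d $ u - d $ w) = 0"
  have "d $ B0 = 0"
    using 2 1 by (simp add: parts_def chain_conf_def inner_5 vec_eq_iff[where x="d $ B0"] forall_5)
  with 1 show "d = 0"
    by (metis ComplI singletonD vec_eq_iff zero_index)
qed

text \<open>The seven points affinely span the space, so their dependencies form a line, on which
  the coefficient at \<open>Y0\<close> serves as coordinate.\<close>

lemma affine_independent_part13:
  assumes "(\<Sum>z\<in>part1 \<union> part3. m z) = 0" "(\<Sum>z\<in>part1 \<union> part3. m z *\<^sub>R chain_conf \<sigma> $ z) = 0"
    "m Y0 = 0" "\<sigma> \<noteq> 0" "z \<in> part1 \<union> part3"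
  shows "m z = (0::real)"
  using assms by (auto simp: parts_def chain_conf_def vec_eq_iff forall_5)

lemma affine_independent_part24:
  assumes "(\<Sum>z\<in>part2 \<union> part4. m z) = 0" "(\<Sum>z\<in>part2 \<union> part4. m z *\<^sub>R chain_conf \<sigma> $ z) = 0"
    "m X0 = 0" "\<sigma> \<noteq> 0" "z \<in> part2 \<union> part4"
  shows "m z = (0::real)"
  using assms by (auto simp: parts_def chain_conf_def vec_eq_iff forall_5)

lemma inf_rigid_chain_conf: "inf_rigid (part1 \<union> part4) chain_pairs (chain_conf 1)"
  unfolding inf_rigid_def
proof (intro allI impI)
  fix d :: "(real^5)^chain_vertex"
  assume 1: "\<forall>v\<in>part1 \<union> part4. d $ v = 0"
    and 2: "\<forall>(u, w)\<in>chain_pairs. (chain_conf 1 $ u - chain_conf 1 $ w) \<bullet> (d $ u - d $ w) = 0"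
  have pins: "d $ A0 = 0" "d $ A1 = 0" "d $ B0 = 0" "d $ B1 = 0" "d $ B2 = 0" "d $ B3 = 0"
    using 1 by (auto simp: parts_def)
  have eq: "(chain_position 1 u - chain_position 1 w) \<bullet> (d $ u - d $ w) = 0"
    if "(u, w) \<in> chain_pairs" for u w
    using 2 that by (auto simp: chain_conf_def)
  have BY: "y \<in> part3 \<Longrightarrow> (chain_position 1 b - chain_position 1 y) \<bullet> d $ y = 0" if "b \<in> part4" for b y
    using eq[of b y] that 1 by (simp add: chain_pairs_def inner_diff_right)
  \<comment> \<open>\<open>B0\<close> is the origin and \<open>B1\<close>, \<open>B2\<close>,
    \<open>B3\<close> are the first three unit vectors, so differences of the four equations isolate
    the first three components.\<close>
  have Y: "y \<in> part3 \<Longrightarrow> d $ y $ 1 = 0 \<and> d $ y $ 2 = 0 \<and> d $ y $ 3 = 0 \<and> chain_position 1 y \<bullet> d $ y = 0" for y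
    using BY[of B0 y] BY[of B1 y] BY[of B2 y] BY[of B3 y] by (simp add: part4_def inner_5 algebra_simps)
  have Y': "d $ Y0 $ 5 = 0" "d $ Y1 $ 4 = 0" "d $ Y2 $ 5 = 0" "d $ Y3 $ 4 = 0" "d $ Y4 $ 4 = 0"
    using Y[of Y0] Y[of Y1] Y[of Y2] Y[of Y3] Y[of Y4] by (simp_all add: part3_def inner_5)
  have XA: "x \<in> part2 \<Longrightarrow> a \<in> part1 \<Longrightarrow> (chain_position 1 x - chain_position 1 a) \<bullet> d $ x = 0" for a x
    using eq[of x a] 1 by (simp add: chain_pairs_def inner_diff_right)
  have XY: "x \<in> part2 \<Longrightarrow> y \<in> part3 \<Longrightarrow> (chain_position 1 x - chain_position 1 y) \<bullet> (d $ x - d $ y) = 0" for x y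
    using eq[of x y] by (simp add: chain_pairs_def)
  have X: "x \<in> part2 \<Longrightarrow>
    (chain_position 1 x - chain_position 1 A0) \<bullet> d $ x = 0 \<and> (chain_position 1 x - chain_position 1 A1) \<bullet> d $ x = 0 \<and>
    (chain_position 1 x - chain_position 1 Y0) \<bullet> (d $ x - d $ Y0) = 0 \<and>
    (chain_position 1 x - chain_position 1 Y1) \<bullet> (d $ x - d $ Y1) = 0 \<and>
    (chain_position 1 x - chain_position 1 Y2) \<bullet> (d $ x - d $ Y2) = 0 \<and>
    (chain_position 1 x - chain_position 1 Y3) \<bullet> (d $ x - d $ Y3) = 0 \<and>
    (chain_position 1 x - chain_position 1 Y4) \<bullet> (d $ x - d $ Y4) = 0" for x
    using XA[of x A0] XA[of x A1] XY[of x Y0] XY[of x Y1] XY[of x Y2] XY[of x Y3] XY[of x Y4]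
    by (simp add: part1_def part3_def)
  note Y0 = Y[of Y0, unfolded part3_def, simplified] and Y1 = Y[of Y1, unfolded part3_def, simplified]
    and Y2 = Y[of Y2, unfolded part3_def, simplified] and Y3 = Y[of Y3, unfolded part3_def, simplified]
    and Y4 = Y[of Y4, unfolded part3_def, simplified]
  \<comment> \<open>Each \<open>Y\<close> keeps one unknown component. With the three
    \<open>X\<close> this leaves 20 unknowns in 21 linear equations.\<close>
  note Xs = X[of X0, unfolded part2_def inner_5, simplified, simplified Y0 Y1 Y2 Y3 Y4 Y', simplified]
    X[of X1, unfolded part2_def inner_5, simplified, simplified Y0 Y1 Y2 Y3 Y4 Y', simplified]
    X[of X2, unfolded part2_def inner_5, simplified, simplified Y0 Y1 Y2 Y3 Y4 Y', simplified]
  have Ys: "d $ Y0 $ 4 = 0" "d $ Y1 $ 5 = 0" "d $ Y2 $ 4 = 0" "d $ Y3 $ 5 = 0" "d $ Y4 $ 5 = 0"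
    using Xs by argo+
  have X0: "d $ X0 $ 1 = 0" "d $ X0 $ 2 = 0" "d $ X0 $ 3 = 0" "d $ X0 $ 4 = 0" "d $ X0 $ 5 = 0"
    and X1: "d $ X1 $ 1 = 0" "d $ X1 $ 2 = 0" "d $ X1 $ 3 = 0" "d $ X1 $ 4 = 0" "d $ X1 $ 5 = 0"
    and X2: "d $ X2 $ 1 = 0" "d $ X2 $ 2 = 0" "d $ X2 $ 3 = 0" "d $ X2 $ 4 = 0" "d $ X2 $ 5 = 0"
    using Xs Ys by argo+
  have zero: "x = 0" if "x $ 1 = 0" "x $ 2 = 0" "x $ 3 = 0" "x $ 4 = 0" "x $ 5 = 0" for x :: "real^5"
    using that by (simp add: vec_eq_iff forall_5)
  have "d $ X0 = 0" "d $ X1 = 0" "d $ X2 = 0"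
    by (intro zero X0 X1 X2)+
  moreover have "d $ Y0 = 0" "d $ Y1 = 0" "d $ Y2 = 0" "d $ Y3 = 0" "d $ Y4 = 0"
    by (rule zero; use Y0 Y1 Y2 Y3 Y4 Y' Ys in simp)+
  ultimately have "d $ v = 0" for v
    using pins by (cases v) simp_all
  then show "d = 0"
    by (simp add: vec_eq_iff)
qed

text \<open>The dependency removes all terms containing \<open>y\<close>, and what remains is affine
  in \<open>x\<close>. A second affine dependency, among several points \<open>x\<close>, therefore
  annihilates the sum.\<close>

lemma sum_inner_affine_dependency:
  fixes u e :: "'i \<Rightarrow> 'b::real_inner"
  assumes "(\<Sum>z\<in>Z. l z) = 0" "(\<Sum>z\<in>Z. l z *\<^sub>R u z) = 0"
  shows "(\<Sum>z\<in>Z. l z * ((x - u z) \<bullet> (y - e z))) =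
    (\<Sum>z\<in>Z. l z * (u z \<bullet> e z)) - x \<bullet> (\<Sum>z\<in>Z. l z *\<^sub>R e z)"
proof -
  have "(\<Sum>z\<in>Z. l z * ((x - u z) \<bullet> (y - e z))) =
      (\<Sum>z\<in>Z. l z) * (x \<bullet> y) - x \<bullet> (\<Sum>z\<in>Z. l z *\<^sub>R e z) -
      (\<Sum>z\<in>Z. l z *\<^sub>R u z) \<bullet> y + (\<Sum>z\<in>Z. l z * (u z \<bullet> e z))"
    by (simp add: inner_sum_left inner_sum_right inner_diff_left inner_diff_right sum_distrib_right
        algebra_simps sum.distrib sum_subtractf)
  then show ?thesis
    using assms by simp
qed

text \<open>The missing pairs join two pins, where the edge condition holds trivially. This permits
  sums over a full product.\<close>

lemma chain_pairs_eq: "chain_pairs = (part2 \<union> part4) \<times> (part1 \<union> part3) - part4 \<times> part1"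
  by (auto simp: chain_pairs_def parts_def)

text \<open>Every affine dependency of \<^term>\<open>part1 \<union> part3\<close> together with one of \<^term>\<open>part2 \<union> part4\<close> gives,
  by multiplication, a self-stress. As this stress vanishes nowhere, any single edge condition follows
  from the others.\<close>

lemma inf_rigid_chain_conf_remove_pair:
  "inf_rigid (part1 \<union> part4) (chain_pairs - {e}) (chain_conf 1)"
  unfolding inf_rigid_def
proof (intro allI impI)
  fix d :: "(real^5)^chain_vertex"
  assume pins: "\<forall>v\<in>part1 \<union> part4. d $ v = 0"
    and E: "\<forall>(u, w)\<in>chain_pairs - {e}. (chain_conf 1 $ u - chain_conf 1 $ w) \<bullet> (d $ u - d $ w) = 0"
  define g where "g w z = (chain_conf 1 $ w - chain_conf 1 $ z) \<bullet> (d $ w - d $ z)" for w z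
  define l where "l = chain_dependency"
  let ?W = "part2 \<union> part4" and ?Z = "part1 \<union> part3"
  have g0: "g w z = 0" if "(w, z) \<in> ?W \<times> ?Z" "(w, z) \<noteq> e" for w z
    using pins E that by (auto simp: g_def chain_pairs_eq)
  \<comment> \<open>This sum vanishes for every \<open>d\<close> because the two dependencies act
    one after the other. Only the term of \<open>e\<close> is not yet known to be zero.\<close>
  have "(\<Sum>w\<in>?W. \<Sum>z\<in>?Z. l w * l z * g w z) = (\<Sum>w\<in>?W. l w * (\<Sum>z\<in>?Z. l z * g w z))"
    by (simp add: sum_distrib_left mult.assoc)
  also have "\<dots> = (\<Sum>w\<in>?W. l w * ((\<Sum>z\<in>?Z. l z * (chain_conf 1 $ z \<bullet> d $ z)) -
      chain_conf 1 $ w \<bullet> (\<Sum>z\<in>?Z. l z *\<^sub>R d $ z)))"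
    unfolding g_def l_def
    by (intro sum.cong refl arg_cong2[where f="(*)"] sum_inner_affine_dependency
        chain_dependency_sum chain_dependency_affine)
  also have "\<dots> = (\<Sum>w\<in>?W. l w) * (\<Sum>z\<in>?Z. l z * (chain_conf 1 $ z \<bullet> d $ z)) -
      (\<Sum>w\<in>?W. l w *\<^sub>R chain_conf 1 $ w) \<bullet> (\<Sum>z\<in>?Z. l z *\<^sub>R d $ z)"
    by (simp only: right_diff_distrib sum_subtractf sum_distrib_right[symmetric] inner_sum_left inner_scaleR_left)
  also have "\<dots> = 0"
    by (simp only: l_def chain_dependency_sum chain_dependency_affine) simp
  finally have "(\<Sum>(w, z)\<in>?W \<times> ?Z. l w * l z * g w z) = 0"
    by (simp add: sum.cartesian_product)
  moreover have "(\<Sum>(w, z)\<in>?W \<times> ?Z. l w * l z * g w z) = l (fst e) * l (snd e) * g (fst e) (snd e)"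
    if "e \<in> ?W \<times> ?Z"
  proof -
    have "(\<Sum>(w, z)\<in>?W \<times> ?Z. l w * l z * g w z) = (\<Sum>(w, z)\<in>{e}. l w * l z * g w z)"
    proof (rule sum.mono_neutral_right)
      show "\<forall>i\<in>?W \<times> ?Z - {e}. (case i of (w, z) \<Rightarrow> l w * l z * g w z) = 0"
      proof
        fix i assume i: "i \<in> ?W \<times> ?Z - {e}"
        have "g (fst i) (snd i) = 0"
          by (rule g0) (use i in \<open>simp_all add: mem_Times_iff\<close>)
        then show "(case i of (w, z) \<Rightarrow> l w * l z * g w z) = 0"
          by (simp add: case_prod_beta)
      qed
    qed (use that in auto)
    then show ?thesis by (simp add: case_prod_beta)
  qed
  ultimately have ge: "g (fst e) (snd e) = 0" if "e \<in> ?W \<times> ?Z"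
    using that by (simp add: l_def chain_dependency_nonzero)
  have "g w z = 0" if "(w, z) \<in> chain_pairs" for w z
  proof -
    have wz: "(w, z) \<in> ?W \<times> ?Z"
      by (rule subsetD[OF _ that]) (simp add: chain_pairs_eq Diff_subset)
    show ?thesis
    proof (cases "(w, z) = e")
      case True
      then show ?thesis using ge wz by (metis fst_conv snd_conv)
    next
      case False
      with wz show ?thesis by (rule g0)
    qed
  qed
  then have "\<forall>(u, w)\<in>chain_pairs. (chain_conf 1 $ u - chain_conf 1 $ w) \<bullet> (d $ u - d $ w) = 0"
    unfolding g_def by blast
  then show "d = 0"
    using inf_rigid_chain_conf pins unfolding inf_rigid_def by blast
qed

subsection \<open>Equivalent positions of the chain\<close>

text \<open>The lengths of the 11 omitted pairs \<open>(w, Y0)\<close> with \<open>w \<noteq> B0\<close> and \<open>(X0, z)\<close> with \<open>z \<noteq> A0\<close> are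
  determined by the linear relations between the lengths.\<close>

definition kept_pairs :: "(chain_vertex \<times> chain_vertex) set" where
  "kept_pairs = {(X0, A0)} \<union> ({X1, X2} \<times> {A0, A1, Y1, Y2, Y3, Y4} \<union>
     ({B1, B2, B3} \<times> {Y1, Y2, Y3, Y4} \<union> {B0} \<times> {Y0, Y1, Y2, Y3, Y4}))"

text \<open>Weighted by \<open>l\<close>, all rows of \<open>D\<close> have the same sum, and so
  have all columns. Row \<open>B0\<close> and column \<open>A0\<close> consist of known zeros, so
  both sums are 0. The rows then yield the entries at \<open>Y0\<close>, the columns those at
  \<open>X0\<close>, and the corner comes last. It serves both for derivatives and for differences
  of two configurations.\<close>

lemma chain_pairs_from_kept_pairs:
  fixes u e :: "chain_vertex \<Rightarrow> 'b::real_inner"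
  assumes l: "(\<Sum>z\<in>part1 \<union> part3. l z) = 0" "(\<Sum>w\<in>part2 \<union> part4. l w) = 0" "l Y0 \<noteq> 0" "l X0 \<noteq> 0"
    and u: "(\<Sum>z\<in>part1 \<union> part3. l z *\<^sub>R u z) = 0" "(\<Sum>w\<in>part2 \<union> part4. l w *\<^sub>R u w) = 0"
    and e: "(\<Sum>z\<in>part1 \<union> part3. l z *\<^sub>R e z) = 0" "(\<Sum>w\<in>part2 \<union> part4. l w *\<^sub>R e w) = 0"
    and pins: "\<And>v. v \<in> part1 \<union> part4 \<Longrightarrow> e v = 0"
    and kept: "\<And>w z. (w, z) \<in> kept_pairs \<Longrightarrow> (u w - u z) \<bullet> (e w - e z) = 0"
    and "(w, z) \<in> chain_pairs"
  shows "(u w - u z) \<bullet> (e w - e z) = 0"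
proof -
  define D where "D w z = (u w - u z) \<bullet> (e w - e z)" for w z
  define \<kappa> where "\<kappa> = (\<Sum>z\<in>part1 \<union> part3. l z * (u z \<bullet> e z))"
  define \<kappa>' where "\<kappa>' = (\<Sum>w\<in>part2 \<union> part4. l w * (u w \<bullet> e w))"
  have row: "(\<Sum>z\<in>part1 \<union> part3. l z * D w z) = \<kappa>" for w
    using sum_inner_affine_dependency[OF l(1) u(1), of "u w" "e w" e] e by (simp add: D_def \<kappa>_def)
  have col: "(\<Sum>w\<in>part2 \<union> part4. l w * D w z) = \<kappa>'" for z
  proof -
    have "D w z = (u z - u w) \<bullet> (e z - e w)" for w
      unfolding D_def by (metis inner_minus_left inner_minus_right minus_diff_eq minus_minus)
    then show ?thesis
      using sum_inner_affine_dependency[OF l(2) u(2), of "u z" "e z" e] e by (simp add: \<kappa>'_def)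
  qed
  have 0: "D w z = 0" if "(w, z) \<in> kept_pairs \<union> part4 \<times> part1" for w z
    using that kept pins by (auto simp: D_def)
  note [simp] = 0[unfolded kept_pairs_def chain_pairs_def parts_def, simplified]
  have "\<kappa> = 0"
    using row[of B0] by (simp add: parts_def)
  moreover have "\<kappa>' = 0"
    using col[of A0] by (simp add: parts_def)
  ultimately have "D w Y0 = 0" if "w \<in> {X1, X2, B1, B2, B3}" for w
    using row[of w] that l(3) by (auto simp: parts_def)
  moreover have "D X0 z = 0" if "z \<in> {A1, Y1, Y2, Y3, Y4}" for z
    using col[of z] that l(4) \<open>\<kappa>' = 0\<close> by (auto simp: parts_def)
  moreover have "D X0 Y0 = 0"
    using col[of Y0] l(4) \<open>\<kappa>' = 0\<close> calculation(1) by (auto simp: parts_def)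
  ultimately have "D w z = 0"
    using assms(11) by (cases w; cases z) (simp_all add: chain_pairs_def parts_def)
  then show ?thesis
    by (simp add: D_def)
qed

section \<open>A square system for the equivalent position\<close>

text \<open>For a given position p the unknowns are the coefficients l and the position q, which are
  14 + 70 numbers, against 20 + 4 + 30 + 30 equations. The \<open>Dep\<close> and
  \<open>Flat\<close> equations make l a dependency of p and of q, and \<open>Norm1\<close>,
  \<open>Norm2\<close> fix its scale. As an unknown, l adapts to p without being solved for.\<close>

datatype chain_equation =
  Dep1 5 | Dep2 5 | Flat1 5 | Flat2 5 | Sum1 | Sum2 | Norm1 | Norm2 | Pin chain_vertex 5 | Length chain_vertex chain_vertex

definition chain_equations :: "chain_equation set" where
  "chain_equations = range Dep1 \<union> range Dep2 \<union> range Flat1 \<union> range Flat2 \<union> {Sum1, Sum2, Norm1, Norm2} \<union>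
     (\<lambda>(v, i). Pin v i) ` ((part1 \<union> part4) \<times> UNIV) \<union> (\<lambda>(w, z). Length w z) ` kept_pairs"

type_synonym chain_point = "((real^5)^chain_vertex) \<times> ((real^chain_vertex) \<times> ((real^5)^chain_vertex))"

primrec chain_residual :: "chain_equation \<Rightarrow> chain_point \<Rightarrow> real" where
  "chain_residual (Dep1 i) x = (\<Sum>z\<in>part1 \<union> part3. fst (snd x) $ z *\<^sub>R fst x $ z) $ i"
| "chain_residual (Dep2 i) x = (\<Sum>w\<in>part2 \<union> part4. fst (snd x) $ w *\<^sub>R fst x $ w) $ i"
| "chain_residual (Flat1 i) x = (\<Sum>z\<in>part1 \<union> part3. fst (snd x) $ z *\<^sub>R snd (snd x) $ z) $ i"
| "chain_residual (Flat2 i) x = (\<Sum>w\<in>part2 \<union> part4. fst (snd x) $ w *\<^sub>R snd (snd x) $ w) $ i"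
| "chain_residual Sum1 x = (\<Sum>z\<in>part1 \<union> part3. fst (snd x) $ z)"
| "chain_residual Sum2 x = (\<Sum>w\<in>part2 \<union> part4. fst (snd x) $ w)"
| "chain_residual Norm1 x = fst (snd x) $ Y0 - chain_dependency Y0"
| "chain_residual Norm2 x = fst (snd x) $ X0 - chain_dependency X0"
| "chain_residual (Pin v i) x = (snd (snd x) $ v - fst x $ v) $ i"
| "chain_residual (Length w z) x =
     ((snd (snd x) $ w - snd (snd x) $ z) \<bullet> (snd (snd x) $ w - snd (snd x) $ z)) -
     ((fst x $ w - fst x $ z) \<bullet> (fst x $ w - fst x $ z))"

primrec chain_residual_deriv :: "chain_point \<Rightarrow> chain_equation \<Rightarrow> chain_point \<Rightarrow> real" where
  "chain_residual_deriv x (Dep1 i) h = (\<Sum>z\<in>part1 \<union> part3.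
     fst (snd x) $ z *\<^sub>R fst h $ z + fst (snd h) $ z *\<^sub>R fst x $ z) $ i"
| "chain_residual_deriv x (Dep2 i) h = (\<Sum>w\<in>part2 \<union> part4.
     fst (snd x) $ w *\<^sub>R fst h $ w + fst (snd h) $ w *\<^sub>R fst x $ w) $ i"
| "chain_residual_deriv x (Flat1 i) h = (\<Sum>z\<in>part1 \<union> part3.
     fst (snd x) $ z *\<^sub>R snd (snd h) $ z + fst (snd h) $ z *\<^sub>R snd (snd x) $ z) $ i"
| "chain_residual_deriv x (Flat2 i) h = (\<Sum>w\<in>part2 \<union> part4.
     fst (snd x) $ w *\<^sub>R snd (snd h) $ w + fst (snd h) $ w *\<^sub>R snd (snd x) $ w) $ i"
| "chain_residual_deriv x Sum1 h = (\<Sum>z\<in>part1 \<union> part3. fst (snd h) $ z)"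
| "chain_residual_deriv x Sum2 h = (\<Sum>w\<in>part2 \<union> part4. fst (snd h) $ w)"
| "chain_residual_deriv x Norm1 h = fst (snd h) $ Y0"
| "chain_residual_deriv x Norm2 h = fst (snd h) $ X0"
| "chain_residual_deriv x (Pin v i) h = (snd (snd h) $ v - fst h $ v) $ i"
| "chain_residual_deriv x (Length w z) h =
     2 * ((snd (snd x) $ w - snd (snd x) $ z) \<bullet> (snd (snd h) $ w - snd (snd h) $ z)) -
     2 * ((fst x $ w - fst x $ z) \<bullet> (fst h $ w - fst h $ z))"

lemma has_derivative_chain_residual:
  "(chain_residual k has_derivative chain_residual_deriv x k) (at x)"
proof -
  have nth: "((\<lambda>x. f x $ i) has_derivative (\<lambda>h. f' h $ i)) F" if "(f has_derivative f') F"
    for f f' :: "chain_point \<Rightarrow> 'b::real_normed_vector^'n" and i F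
    using that by (rule bounded_linear.has_derivative[OF bounded_linear_vec_nth])
  have 1: "((\<lambda>x. fst x $ v) has_derivative (\<lambda>h. fst h $ v)) (at x)"
    and 2: "((\<lambda>x. fst (snd x) $ v) has_derivative (\<lambda>h. fst (snd h) $ v)) (at x)"
    and 3: "((\<lambda>x. snd (snd x) $ v) has_derivative (\<lambda>h. snd (snd h) $ v)) (at x)"
    for v and x :: chain_point
    by (intro nth has_derivative_fst has_derivative_snd has_derivative_ident)+
  show ?thesis
  proof (cases k)
    case (Length w z)
    show ?thesis
      unfolding Length chain_residual.simps[abs_def] chain_residual_deriv.simps[abs_def]
      by (rule has_derivative_eq_rhs, (rule has_derivative_diff has_derivative_inner 1 3)+)
        (simp add: fun_eq_iff inner_commute)
  qed (simp only: chain_residual.simps[abs_def] chain_residual_deriv.simps[abs_def],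
      rule has_derivative_eq_rhs,
      (rule nth has_derivative_sum has_derivative_diff has_derivative_scaleR has_derivative_const 1 2 3)+, simp)+
qed

lemma continuous_on_chain_residual: "continuous_on UNIV (chain_residual k)"
  by (meson has_derivative_chain_residual continuous_at_imp_continuous_on has_derivative_continuous)

lemma card_kept_pairs: "card kept_pairs = 30"
  unfolding kept_pairs_def
  by (subst card_Un_disjoint, simp, simp, blast)+ (simp add: card_cartesian_product)

lemma card_chain_equations: "card chain_equations = 84"
proof -
  have 1: "card (range Dep1) = 5" "card (range Dep2) = 5" "card (range Flat1) = 5" "card (range Flat2) = 5"
    by (subst card_image; simp add: inj_def)+
  have 2: "card ((\<lambda>(v, i). Pin v i) ` ((part1 \<union> part4) \<times> UNIV)) = 30"
  proof (subst card_image)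
    show "inj_on (\<lambda>(v, i). Pin v i) ((part1 \<union> part4) \<times> UNIV)"
      by (auto simp: inj_on_def)
    show "card ((part1 \<union> part4) \<times> (UNIV :: 5 set)) = 30"
      unfolding card_cartesian_product by (simp add: parts_def)
  qed
  have 3: "card ((\<lambda>(w, z). Length w z) ` kept_pairs) = 30"
  proof (subst card_image)
    show "inj_on (\<lambda>(w, z). Length w z) kept_pairs"
      by (auto simp: inj_on_def)
  qed (rule card_kept_pairs)
  have card_Un: "card (A \<union> B) = a + b"
    if "card A = a" "card B = b" "finite A" "finite B" "A \<inter> B = {}" for A B :: "chain_equation set" and a b
    using that by (simp add: card_Un_disjoint)
  have "chain_equations = range Dep1 \<union> (range Dep2 \<union> (range Flat1 \<union> (range Flat2 \<union> ({Sum1, Sum2, Norm1, Norm2} \<union>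
     ((\<lambda>(v, i). Pin v i) ` ((part1 \<union> part4) \<times> UNIV) \<union> (\<lambda>(w, z). Length w z) ` kept_pairs)))))"
    unfolding chain_equations_def by (simp only: Un_assoc)
  also have "card \<dots> = 5 + (5 + (5 + (5 + (4 + (30 + 30)))))"
    by (intro card_Un 1 2 3) auto
  finally show ?thesis by simp
qed

lemma CARD_chain_vertex: "CARD(chain_vertex) = 14"
  unfolding UNIV_chain_vertex by simp

text \<open>\<^term>\<open>chain_conf (-1)\<close> and \<^term>\<open>chain_conf 1\<close> are equivalent, not congruent, and have the same
  affine dependencies.  The equations select among the configurations near \<^term>\<open>chain_conf 1\<close> those with
  the dependencies of a given configuration near \<^term>\<open>chain_conf (-1)\<close>; within this affine subspace 30
  of the lengths determine all 41.\<close>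

lemma equivalent_chain_nearby:
  "\<exists>\<delta>>0. \<forall>p. dist p (chain_conf (-1)) < \<delta> \<longrightarrow>
     (\<exists>q. (\<forall>v\<in>part1 \<union> part4. q $ v = p $ v) \<and>
       (\<forall>(w, z)\<in>chain_pairs. norm (q $ w - q $ z) = norm (p $ w - p $ z)) \<and>
       norm (q $ Y3 - q $ A0) \<noteq> norm (p $ Y3 - p $ A0))"
proof -
  define l\<^sub>0 :: "real^chain_vertex" where "l\<^sub>0 = (\<chi> v. chain_dependency v)"
  let ?p\<^sub>0 = "chain_conf (-1)" and ?q\<^sub>0 = "chain_conf 1"
  have card: "card chain_equations = DIM((real^chain_vertex) \<times> ((real^5)^chain_vertex))"
    by (simp add: card_chain_equations CARD_chain_vertex)
  have zero: "chain_residual k (?p\<^sub>0, (l\<^sub>0, ?q\<^sub>0)) = 0" if "k \<in> chain_equations" for k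
  proof (cases k)
    case (Pin v i)
    then have "v \<in> part1 \<union> part4"
      using that by (auto simp: chain_equations_def)
    then show ?thesis
      using Pin by (auto simp: chain_conf_def parts_def)
  next
    case (Length w z)
    then have "(w, z) \<in> chain_pairs"
      using that by (auto simp: chain_equations_def kept_pairs_def chain_pairs_def parts_def)
    from chain_conf_equivalent[OF this, of 1] show ?thesis
      using Length by (simp add: norm_eq)
  qed (simp_all add: l\<^sub>0_def chain_dependency_affine chain_dependency_sum)
  \<comment> \<open>The \<open>Dep\<close> equations do not involve q and, with the sums and norms,
    force l = 0. The linearised \<open>Flat\<close> equations then concern q alone, and
    infinitesimal rigidity of \<open>chain_conf 1\<close> gives q = 0.\<close>
  have inj: "v = 0"
    if v: "\<And>k. k \<in> chain_equations \<Longrightarrow> chain_residual_deriv (?p\<^sub>0, (l\<^sub>0, ?q\<^sub>0)) k (0, v) = 0" for v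
  proof -
    obtain l q where lq: "v = (l, q)" by fastforce
    have "(\<Sum>z\<in>part1 \<union> part3. l $ z *\<^sub>R ?p\<^sub>0 $ z) = 0" "(\<Sum>w\<in>part2 \<union> part4. l $ w *\<^sub>R ?p\<^sub>0 $ w) = 0"
      using v[of "Dep1 _"] v[of "Dep2 _"] lq by (auto simp: chain_equations_def vec_eq_iff)
    moreover have "(\<Sum>z\<in>part1 \<union> part3. l $ z) = 0" "(\<Sum>w\<in>part2 \<union> part4. l $ w) = 0" "l $ Y0 = 0" "l $ X0 = 0"
      using v[of Sum1] v[of Sum2] v[of Norm1] v[of Norm2] lq by (auto simp: chain_equations_def)
    ultimately have "l $ z = 0" for z
      using affine_independent_part13[of "\<lambda>z. l $ z" "-1" z] affine_independent_part24[of "\<lambda>z. l $ z" "-1" z]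
      by (cases z) (simp_all add: parts_def)
    then have l: "l = 0"
      by (simp add: vec_eq_iff)
    have flat: "(\<Sum>z\<in>part1 \<union> part3. chain_dependency z *\<^sub>R q $ z) = 0"
      "(\<Sum>w\<in>part2 \<union> part4. chain_dependency w *\<^sub>R q $ w) = 0"
      using v[of "Flat1 _"] v[of "Flat2 _"] lq l by (auto simp: chain_equations_def vec_eq_iff l\<^sub>0_def)
    have pins: "q $ v = 0" if "v \<in> part1 \<union> part4" for v
      using v[of "Pin v _"] lq that by (auto simp: chain_equations_def vec_eq_iff image_iff)
    have "(?q\<^sub>0 $ w - ?q\<^sub>0 $ z) \<bullet> (q $ w - q $ z) = 0" if "(w, z) \<in> kept_pairs" for w z
      using v[of "Length w z"] lq that by (auto simp: chain_equations_def)
    then have "(?q\<^sub>0 $ w - ?q\<^sub>0 $ z) \<bullet> (q $ w - q $ z) = 0" if "(w, z) \<in> chain_pairs" for w z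
      by (intro chain_pairs_from_kept_pairs[OF chain_dependency_sum chain_dependency_nonzero chain_dependency_nonzero
            chain_dependency_affine flat pins _ that])
    then have "q = 0"
      using inf_rigid_chain_conf pins unfolding inf_rigid_def by blast
    with l lq show ?thesis by (simp add: zero_prod_def)
  qed
  \<comment> \<open>\<open>Y3\<close> and \<open>A0\<close> lie in the same class and are not
    adjacent. Their squared distances in the two positions are 6 and 2, and being different is an
    open condition.\<close>
  define U where "U = {x :: ((real^5)^chain_vertex) \<times> ((real^5)^chain_vertex).
      norm (snd x $ Y3 - snd x $ A0) \<noteq> norm (fst x $ Y3 - fst x $ A0)}"
  have "open U"
    unfolding U_def by (intro open_Collect_neq continuous_intros)
  moreover have "(?p\<^sub>0, ?q\<^sub>0) \<in> U"
    by (simp add: U_def norm_eq inner_5 chain_conf_def)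
  ultimately obtain r where r: "r > 0" "\<And>x. dist x (?p\<^sub>0, ?q\<^sub>0) < r \<Longrightarrow> x \<in> U"
    unfolding open_dist by blast
  have "finite chain_equations"
    by (rule card_ge_0_finite) (simp add: card_chain_equations)
  then have "\<exists>\<delta>>0. \<forall>p. dist p ?p\<^sub>0 < \<delta> \<longrightarrow>
      (\<exists>v. dist v (l\<^sub>0, ?q\<^sub>0) < r/2 \<and> (\<forall>k\<in>chain_equations. chain_residual k (p, v) = 0))"
    using r(1)
    by (intro implicit_solution_nearby[where E = chain_residual
          and E' = "chain_residual_deriv (?p\<^sub>0, (l\<^sub>0, ?q\<^sub>0))"] card
        continuous_on_chain_residual has_derivative_chain_residual zero inj) auto
  then obtain \<delta> where \<delta>: "\<delta> > 0" "\<And>p. dist p ?p\<^sub>0 < \<delta> \<Longrightarrow>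
      \<exists>v. dist v (l\<^sub>0, ?q\<^sub>0) < r/2 \<and> (\<forall>k\<in>chain_equations. chain_residual k (p, v) = 0)"
    by blast
  show ?thesis
  proof (intro exI[of _ "min \<delta> (r/2)"] conjI allI impI)
    fix p assume p: "dist p ?p\<^sub>0 < min \<delta> (r/2)"
    then obtain l q where d: "dist (l, q) (l\<^sub>0, ?q\<^sub>0) < r/2"
      and res: "\<And>k. k \<in> chain_equations \<Longrightarrow> chain_residual k (p, (l, q)) = 0"
      using \<delta>(2)[of p] by auto
    have dep: "(\<Sum>z\<in>part1 \<union> part3. l $ z *\<^sub>R p $ z) = 0" "(\<Sum>w\<in>part2 \<union> part4. l $ w *\<^sub>R p $ w) = 0"
      using res[of "Dep1 _"] res[of "Dep2 _"] by (auto simp: chain_equations_def vec_eq_iff)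
    have flat: "(\<Sum>z\<in>part1 \<union> part3. l $ z *\<^sub>R q $ z) = 0" "(\<Sum>w\<in>part2 \<union> part4. l $ w *\<^sub>R q $ w) = 0"
      using res[of "Flat1 _"] res[of "Flat2 _"] by (auto simp: chain_equations_def vec_eq_iff)
    have sums: "(\<Sum>z\<in>part1 \<union> part3. l $ z) = 0" "(\<Sum>w\<in>part2 \<union> part4. l $ w) = 0" "l $ Y0 \<noteq> 0" "l $ X0 \<noteq> 0"
      using res[of Sum1] res[of Sum2] res[of Norm1] res[of Norm2] by (auto simp: chain_equations_def)
    have pins: "q $ v = p $ v" if "v \<in> part1 \<union> part4" for v
      using res[of "Pin v _"] that by (auto simp: chain_equations_def vec_eq_iff image_iff)
    \<comment> \<open>A difference of squared lengths is bilinear in \<open>q + p\<close> and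
      \<open>q - p\<close>. Both have the dependency \<open>l\<close>, and \<open>q - p\<close>
      vanishes on the pins, so the lemma on kept pairs applies without linearisation.\<close>
    let ?D = "\<lambda>w z. ((q + p) $ w - (q + p) $ z) \<bullet> ((q - p) $ w - (q - p) $ z)"
    have D: "?D w z = (norm (q $ w - q $ z))\<^sup>2 - (norm (p $ w - p $ z))\<^sup>2" for w z
    proof -
      have "(q + p) $ w - (q + p) $ z = (q $ w - q $ z) + (p $ w - p $ z)"
        "(q - p) $ w - (q - p) $ z = (q $ w - q $ z) - (p $ w - p $ z)"
        by simp_all
      then show ?thesis by (simp only: inner_add_diff)
    qed
    have "?D w z = 0" if "(w, z) \<in> kept_pairs" for w z
      unfolding D using res[of "Length w z"] that by (auto simp: chain_equations_def power2_norm_eq_inner)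
    then have "?D w z = 0" if "(w, z) \<in> chain_pairs" for w z
      by (intro chain_pairs_from_kept_pairs[where l = "\<lambda>v. l $ v", OF sums _ _ _ _ _ _ that])
        (simp_all add: scaleR_add_right scaleR_diff_right sum.distrib sum_subtractf dep flat pins)
    then have "\<forall>(w, z)\<in>chain_pairs. norm (q $ w - q $ z) = norm (p $ w - p $ z)"
      unfolding D by auto
    moreover have "norm (q $ Y3 - q $ A0) \<noteq> norm (p $ Y3 - p $ A0)"
    proof -
      have "dist q ?q\<^sub>0 < r / 2"
        using d dist_snd_le[of "(l, q)" "(l\<^sub>0, ?q\<^sub>0)"] by simp
      moreover have "dist (p, q) (?p\<^sub>0, ?q\<^sub>0) \<le> dist p ?p\<^sub>0 + dist q ?q\<^sub>0"
        unfolding dist_Pair_Pair by (rule sqrt_sum_squares_le_sum) auto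
      ultimately have "dist (p, q) (?p\<^sub>0, ?q\<^sub>0) < r"
        using p by simp
      then show ?thesis
        using r(2) by (auto simp: U_def)
    qed
    ultimately show "\<exists>q. (\<forall>v\<in>part1 \<union> part4. q $ v = p $ v) \<and>
       (\<forall>(w, z)\<in>chain_pairs. norm (q $ w - q $ z) = norm (p $ w - p $ z)) \<and>
       norm (q $ Y3 - q $ A0) \<noteq> norm (p $ Y3 - p $ A0)"
      using pins by blast
  qed (use \<delta> r in auto)
qed

subsection \<open>Attaching the chain to a graph\<close>

text \<open>An injection from a fixed type names the chain vertices, which separates all
  computations with coordinates from the graph.\<close>

definition chain_attached :: "(chain_vertex \<Rightarrow> 'a) \<Rightarrow> 'a graph \<Rightarrow> 'a graph \<Rightarrow> bool" where
  "chain_attached \<phi> G H \<longleftrightarrow> inj \<phi> \<and> verts H = verts G \<union> range \<phi> \<and>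
     edges H = edges G \<union> (\<lambda>(w, z). {\<phi> w, \<phi> z}) ` chain_pairs \<and>
     \<phi> ` (part1 \<union> part4) \<subseteq> verts G \<and> \<phi> ` (part2 \<union> part3) \<inter> verts G = {}"

lemma UNIV_parts: "UNIV = part1 \<union> part2 \<union> part3 \<union> part4"
  unfolding UNIV_chain_vertex parts_def by auto

lemma parts_disjoint:
  "part1 \<inter> part2 = {}" "part1 \<inter> part3 = {}" "part1 \<inter> part4 = {}"
  "part2 \<inter> part3 = {}" "part2 \<inter> part4 = {}" "part3 \<inter> part4 = {}"
  by (auto simp: parts_def)

lemma card_parts: "card part1 = 2" "card part2 = 3" "card part3 = 5" "card part4 = 4"
  by (auto simp: parts_def)

lemma four_chain_attachment_labelling:
  assumes "H \<in> four_chain_attachments 2 3 5 4 G"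
  obtains \<phi> where "chain_attached \<phi> G H"
proof -
  obtain P1 P2 P3 P4 where H: "H = graph_union G (four_chain P1 P2 P3 P4)"
    and fin: "finite P1" "finite P2" "finite P3" "finite P4"
    and card: "card P1 = 2" "card P2 = 3" "card P3 = 5" "card P4 = 4"
    and disj: "P1 \<inter> P2 = {}" "P1 \<inter> P3 = {}" "P1 \<inter> P4 = {}" "P2 \<inter> P3 = {}" "P2 \<inter> P4 = {}" "P3 \<inter> P4 = {}"
    and G: "P1 \<subseteq> verts G" "P4 \<subseteq> verts G" "P2 \<inter> verts G = {}" "P3 \<inter> verts G = {}"
    using assms unfolding four_chain_attachments_def by blast
  have "\<exists>f. bij_betw f A B" if "finite B" "card A = card B" for A :: "chain_vertex set" and B :: "'a set"
    using that by (intro finite_same_card_bij) auto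
  then obtain f1 f2 f3 f4 where f: "bij_betw f1 part1 P1" "bij_betw f2 part2 P2" "bij_betw f3 part3 P3" "bij_betw f4 part4 P4"
    using fin card card_parts by metis
  define \<phi> where "\<phi> v = (if v \<in> part1 then f1 v else if v \<in> part2 then f2 v else if v \<in> part3 then f3 v else f4 v)" for v
  have \<phi>_eq: "v \<in> part1 \<Longrightarrow> \<phi> v = f1 v" "v \<in> part2 \<Longrightarrow> \<phi> v = f2 v" "v \<in> part3 \<Longrightarrow> \<phi> v = f3 v" "v \<in> part4 \<Longrightarrow> \<phi> v = f4 v" for v
    using parts_disjoint by (auto simp: \<phi>_def)
  have b: "bij_betw \<phi> part1 P1" "bij_betw \<phi> part2 P2" "bij_betw \<phi> part3 P3" "bij_betw \<phi> part4 P4"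
    using f by (simp_all add: \<phi>_eq cong: bij_betw_cong)
  then have im: "\<phi> ` part1 = P1" "\<phi> ` part2 = P2" "\<phi> ` part3 = P3" "\<phi> ` part4 = P4"
    by (auto simp: bij_betw_def)
  have "bij_betw \<phi> (part1 \<union> part2 \<union> part3 \<union> part4) (P1 \<union> P2 \<union> P3 \<union> P4)"
    using b disj by (intro bij_betw_combine) auto
  then have bij: "bij_betw \<phi> UNIV (P1 \<union> P2 \<union> P3 \<union> P4)"
    by (simp flip: UNIV_parts)
  have "(\<lambda>(w, z). {\<phi> w, \<phi> z}) ` chain_pairs = edges (four_chain P1 P2 P3 P4)"
  proof -
    have eq: "(\<lambda>(w, z). {\<phi> w, \<phi> z}) ` (U \<times> V) = {{x, y} |x y. x \<in> \<phi> ` U \<and> y \<in> \<phi> ` V}" for U V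
      by auto
    \<comment> \<open>Members of \<open>chain_pairs\<close> start in \<open>part2\<close> or
      \<open>part4\<close>, which reverses two of the three layers of
      \<open>four_chain\<close>.\<close>
    have swap: "{{x, y} |x y. x \<in> A \<and> y \<in> B} = {{x, y} |x y. x \<in> B \<and> y \<in> A}" for A B :: "'a set"
      by (metis insert_commute)
    show ?thesis
      unfolding chain_pairs_def image_Un eq im four_chain_def graph.simps
      using swap[of P2 P1] swap[of P4 P3] by simp
  qed
  moreover have "range \<phi> = P1 \<union> P2 \<union> P3 \<union> P4" "inj \<phi>"
    using bij by (auto simp: bij_betw_def)
  ultimately have "chain_attached \<phi> G H"
    using G im unfolding chain_attached_def H graph_union_def four_chain_def by (auto simp: image_Un)
  then show thesis ..
qed

section \<open>Connectivity\<close>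

text \<open>At most 5 vertices are removed, so the rest of \<open>G\<close> stays connected. A
  remaining vertex of \<open>part2\<close> reaches it through \<open>part1\<close>; if that is gone,
  at most 3 further removals exhaust neither \<open>part3\<close> nor \<open>part4\<close>. A vertex
  of \<open>part3\<close> reaches it through \<open>part4\<close>; if that is gone, at most one more
  removal leaves a way through \<open>part2\<close> and \<open>part1\<close>.\<close>

lemma k_connected_chain_attached:
  assumes att: "chain_attached \<phi> G H" and "simple_graph G" and G6: "k_connected 6 G"
  shows "k_connected 6 H"
proof -
  have inj: "inj \<phi>" and vH: "verts H = verts G \<union> range \<phi>"
    and eH: "edges H = edges G \<union> (\<lambda>(w, z). {\<phi> w, \<phi> z}) ` chain_pairs"
    and pins: "\<phi> ` (part1 \<union> part4) \<subseteq> verts G"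
    using att by (auto simp: chain_attached_def)
  have fin: "finite (verts G)" "finite (verts H)"
    using \<open>simple_graph G\<close> by (auto simp: simple_graph_def vH)
  have "6 + 1 \<le> card (verts H)"
    using G6 card_mono[of "verts H" "verts G"] fin by (auto simp: k_connected_def vH)
  moreover have "graph_connected (remove_verts H S)" if S: "S \<subseteq> verts H" "card S < 6" for S
  proof -
    define R where "R = {(x, y). {x, y} \<in> edges (remove_verts H S)}"
    have sym: "sym (R\<^sup>*)"
      by (rule sym_rtrancl) (auto simp: R_def sym_def insert_commute)
    have finS: "finite S"
      using S fin finite_subset by blast
    have "graph_connected (remove_verts G (S \<inter> verts G))"
      using G6 S finS card_mono[of S "S \<inter> verts G"] by (auto simp: k_connected_def)
    moreover have "{(x, y). {x, y} \<in> edges (remove_verts G (S \<inter> verts G))} \<subseteq> R"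
      using \<open>simple_graph G\<close> by (fastforce simp: R_def remove_verts_def eH simple_graph_def)
    ultimately have conG: "(u, v) \<in> R\<^sup>*" if "u \<in> verts G - S" "v \<in> verts G - S" for u v
      using that rtrancl_mono[of "{(x, y). {x, y} \<in> edges (remove_verts G (S \<inter> verts G))}" R]
      by (auto simp: graph_connected_def remove_verts_def)
    define T where "T = \<phi> -` S"
    have R1: "(\<phi> w, \<phi> z) \<in> R" if "(w, z) \<in> chain_pairs \<or> (z, w) \<in> chain_pairs" "w \<notin> T" "z \<notin> T" for w z
      using that by (force simp: R_def remove_verts_def eH T_def insert_commute)
    have "card T \<le> card S"
      using card_vimage_inj_on_le[of \<phi> UNIV S] inj finS by (simp add: T_def)
    have not_sub: "\<not> A \<subseteq> T" if "card A > 5" for A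
    proof
      assume "A \<subseteq> T"
      then have "card A \<le> card T"
        by (intro card_mono) auto
      with \<open>card T \<le> card S\<close> that S show False by linarith
    qed
    have base: "\<exists>g\<in>verts G - S. (u, g) \<in> R\<^sup>*" if u: "u \<in> verts H - S" for u
    proof (cases "u \<in> verts G")
      case True
      then show ?thesis using u by blast
    next
      case False
      then obtain v where v: "u = \<phi> v" "v \<notin> T"
        using u by (auto simp: vH T_def)
      have v23: "v \<in> part2 \<union> part3"
        using False v pins UNIV_parts by blast
      have good: "\<phi> a \<in> verts G - S" if "a \<in> part1 \<union> part4" "a \<notin> T" for a
        using that pins by (auto simp: T_def)
      consider a where "a \<in> part1 - T" "v \<in> part2" | "part1 \<subseteq> T" "v \<in> part2"
        | b where "b \<in> part4 - T" "v \<in> part3" | "part4 \<subseteq> T" "v \<in> part3"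
        using v23 by blast
      then show ?thesis
      proof cases
        case 1
        then have "(u, \<phi> a) \<in> R"
          unfolding v(1) by (intro R1) (use v in \<open>auto simp: chain_pairs_def\<close>)
        then show ?thesis using good[of a] 1 by blast
      next
        case 2
        have "\<not> part1 \<union> part3 \<subseteq> T" "\<not> part1 \<union> part4 \<subseteq> T"
          by (rule not_sub; simp add: parts_def)+
        then obtain y b where yb: "y \<in> part3 - T" "b \<in> part4 - T"
          using 2 by blast
        then have "(u, \<phi> y) \<in> R" "(\<phi> y, \<phi> b) \<in> R"
          unfolding v(1) using v 2 by (auto intro!: R1 simp: chain_pairs_def)
        then show ?thesis using good[of b] yb by (meson DiffE UnI2 converse_rtrancl_into_rtrancl r_into_rtrancl)
      next
        case 3
        then have "(u, \<phi> b) \<in> R"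
          unfolding v(1) by (intro R1) (use v in \<open>auto simp: chain_pairs_def\<close>)
        then show ?thesis using good[of b] 3 by blast
      next
        case 4
        have "\<not> part4 \<union> part2 \<subseteq> T" "\<not> part4 \<union> part1 \<subseteq> T"
          by (rule not_sub; simp add: parts_def)+
        then obtain x a where xa: "x \<in> part2 - T" "a \<in> part1 - T"
          using 4 by blast
        then have "(u, \<phi> x) \<in> R" "(\<phi> x, \<phi> a) \<in> R"
          unfolding v(1) using v 4 by (auto intro!: R1 simp: chain_pairs_def)
        then show ?thesis using good[of a] xa by (meson DiffE UnI1 converse_rtrancl_into_rtrancl r_into_rtrancl)
      qed
    qed
    have "(u, v) \<in> R\<^sup>*" if uv: "u \<in> verts H - S" "v \<in> verts H - S" for u v
    proof -
      obtain g h where "g \<in> verts G - S" "(u, g) \<in> R\<^sup>*" "h \<in> verts G - S" "(v, h) \<in> R\<^sup>*"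
        using base uv by meson
      then show ?thesis
        using conG[of g h] symD[OF sym, of v h] by (meson rtrancl_trans)
    qed
    then show ?thesis
      by (auto simp: graph_connected_def R_def remove_verts_def)
  qed
  ultimately show ?thesis
    by (simp add: k_connected_def)
qed

lemma measurement_eq_iff:
  "measurement G p = measurement G q \<longleftrightarrow> (\<forall>i j. {i, j} \<in> edges G \<longrightarrow> norm (p i - p j) = norm (q i - q j))"
proof
  assume eq: "measurement G p = measurement G q"
  show "\<forall>i j. {i, j} \<in> edges G \<longrightarrow> norm (p i - p j) = norm (q i - q j)"
  proof (intro allI impI)
    fix i j assume "{i, j} \<in> edges G"
    then show "norm (p i - p j) = norm (q i - q j)"
      using fun_cong[OF eq, of "(i, j)"] by (simp add: measurement_def)
  qed
next
  assume "\<forall>i j. {i, j} \<in> edges G \<longrightarrow> norm (p i - p j) = norm (q i - q j)"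
  then show "measurement G p = measurement G q"
    by (auto simp: measurement_def fun_eq_iff restrict_def)
qed

section \<open>Redundant rigidity\<close>

lemma flexing_subgraph:
  assumes "flexing H p T q" "verts G \<subseteq> verts H" "edges G \<subseteq> edges H"
  shows "flexing G p T q"
  using assms unfolding flexing_def measurement_eq_iff by blast

text \<open>Pulling the chain back along the motion of its ends gives a continuous path of configurations
  that keep the ends fixed and are equivalent to an isolated configuration.\<close>

lemma chain_follows_ends:
  fixes p :: "'a \<Rightarrow> real^5" and q :: "real \<Rightarrow> 'a \<Rightarrow> real^5" and \<phi> :: "chain_vertex \<Rightarrow> 'a"
  defines "P \<equiv> \<chi> v. p (\<phi> v)"
  assumes rigid: "inf_rigid (part1 \<union> part4) E P"
    and span: "inf_rigid (- {B0}) ((\<lambda>v. (v, B0)) ` (part1 \<union> part4)) P"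
    and T: "is_interval T" "t\<^sub>0 \<in> T"
    and cont: "\<And>v. continuous_on T (\<lambda>t. q t (\<phi> v))"
    and start: "\<And>v. q t\<^sub>0 (\<phi> v) = p (\<phi> v)"
    and edges: "\<And>t w z. t \<in> T \<Longrightarrow> (w, z) \<in> E \<Longrightarrow> norm (q t (\<phi> w) - q t (\<phi> z)) = norm (p (\<phi> w) - p (\<phi> z))"
    and R: "\<And>t. t \<in> T \<Longrightarrow> orthogonal_transformation (R t)"
    and ends: "\<And>t v. t \<in> T \<Longrightarrow> v \<in> part1 \<union> part4 \<Longrightarrow> q t (\<phi> v) = a t + R t (p (\<phi> v))"
    and "t \<in> T"
  shows "q t (\<phi> v) = a t + R t (p (\<phi> v))"
proof -
  define c :: "real \<Rightarrow> (real^5)^chain_vertex" where "c t = (\<chi> v. inv (R t) (q t (\<phi> v) - a t))" for t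
  have lin: "linear (R t)" "linear (inv (R t))" if "t \<in> T" for t
    using R[OF that] orthogonal_transformation_linear orthogonal_transformation_inv by blast+
  have q_eq: "q t (\<phi> v) = a t + R t (c t $ v)" if "t \<in> T" for t v
    using orthogonal_transformation_surj[OF R[OF that]] by (simp add: c_def surj_f_inv_f)
  have c_ends: "c t $ v = P $ v" if "t \<in> T" "v \<in> part1 \<union> part4" for t v
    using orthogonal_transformation_inj[OF R[OF that(1)]] ends[OF that] by (simp add: c_def P_def inv_f_f)
  \<comment> \<open>Nothing is known about continuity of \<open>a\<close> and \<open>R\<close>.
    \<open>L\<close> takes inner products with differences of the ends; these are expressible by the
    continuous \<open>q\<close> and, as the differences span, a linear left inverse recovers
    \<open>c\<close> from them.\<close>
  define L :: "real^5 \<Rightarrow> real^chain_vertex" where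
    "L u = (\<chi> w. if w \<in> part1 \<union> part4 then (P $ w - P $ B0) \<bullet> u else 0)" for u
  have linL: "linear L"
    by (rule linearI) (auto simp: L_def vec_eq_iff inner_add_right)
  have "u = 0" if "L u = 0" for u
  proof -
    have "(P $ w - P $ B0) \<bullet> u = 0" if "w \<in> part1 \<union> part4" for w
      using \<open>L u = 0\<close> that by (auto simp: L_def vec_eq_iff split: if_splits)
    then have "(\<chi> v. if v = B0 then - u else 0) = (0 :: (real^5)^chain_vertex)"
      using span unfolding inf_rigid_def by (auto simp: inner_diff_right)
    then have "(\<chi> v. if v = B0 then - u else 0) $ B0 = (0 :: (real^5)^chain_vertex) $ B0"
      by (rule arg_cong)
    then show ?thesis
      by simp
  qed
  then have injL: "inj L"
    using linL linear_injective_0 by blast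
  then obtain L' where L': "linear L'" "L' \<circ> L = id"
    using linear_injective_left_inverse[OF linL] by blast
  have B0: "B0 \<in> part1 \<union> part4"
    by (simp add: parts_def)
  have L_c: "L (c t $ v - P $ B0) = (\<chi> w. if w \<in> part1 \<union> part4
      then (q t (\<phi> w) - q t (\<phi> B0)) \<bullet> (q t (\<phi> v) - q t (\<phi> B0)) else 0)" if "t \<in> T" for t v
  proof -
    have "(P $ w - P $ B0) \<bullet> (c t $ v - P $ B0) = (q t (\<phi> w) - q t (\<phi> B0)) \<bullet> (q t (\<phi> v) - q t (\<phi> B0))"
      if w: "w \<in> part1 \<union> part4" for w
    proof -
      have "(P $ w - P $ B0) \<bullet> (c t $ v - P $ B0) = R t (c t $ w - c t $ B0) \<bullet> R t (c t $ v - c t $ B0)"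
        using R[OF \<open>t \<in> T\<close>] c_ends[OF \<open>t \<in> T\<close>] w B0 by (simp add: orthogonal_transformation_def)
      also have "\<dots> = (q t (\<phi> w) - q t (\<phi> B0)) \<bullet> (q t (\<phi> v) - q t (\<phi> B0))"
        using lin(1)[OF \<open>t \<in> T\<close>] by (simp add: q_eq[OF \<open>t \<in> T\<close>] linear_diff)
      finally show ?thesis .
    qed
    then show ?thesis
      by (simp add: L_def vec_eq_iff)
  qed
  have c_eq: "c t $ v = P $ B0 + L' (L (c t $ v - P $ B0))" for t v
    using fun_cong[OF L'(2), of "c t $ v - P $ B0"] by simp
  have "continuous_on T (\<lambda>t. c t $ v)" for v
  proof -
    have "continuous_on T (\<lambda>t. \<chi> w. if w \<in> part1 \<union> part4
        then (q t (\<phi> w) - q t (\<phi> B0)) \<bullet> (q t (\<phi> v) - q t (\<phi> B0)) else 0)"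
    proof (intro continuous_on_vec_lambda)
      fix w
      show "continuous_on T (\<lambda>t. if w \<in> part1 \<union> part4
          then (q t (\<phi> w) - q t (\<phi> B0)) \<bullet> (q t (\<phi> v) - q t (\<phi> B0)) else 0)"
        by (cases "w \<in> part1 \<union> part4") (simp_all only: if_True if_False continuous_on_const
            continuous_on_inner continuous_on_diff cont)
    qed
    then have "continuous_on T (\<lambda>t. L (c t $ v - P $ B0))"
      by (rule continuous_on_eq) (simp only: L_c)
    then have "continuous_on T (\<lambda>t. P $ B0 + L' (L (c t $ v - P $ B0)))"
      by (intro continuous_on_add continuous_on_const linear_continuous_on_compose[OF _ L'(1)])
    then show ?thesis
      by (simp only: c_eq[symmetric])
  qed
  then have "continuous_on T (\<lambda>t. \<chi> v. c t $ v)"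
    by (intro continuous_on_vec_lambda)
  then have contc: "continuous_on T c"
    by simp
  \<comment> \<open>\<open>R t\<^sub>0\<close> is not given as the identity, so the start of the
    path is again identified by injectivity of \<open>L\<close>.\<close>
  have c0: "c t\<^sub>0 = P"
  proof -
    have "L (c t\<^sub>0 $ v - P $ B0) = L (P $ v - P $ B0)" for v
      unfolding L_c[OF T(2)] by (simp add: L_def vec_eq_iff start P_def)
    then have "c t\<^sub>0 $ v - P $ B0 = P $ v - P $ B0" for v
      using injL by (metis injD)
    then show ?thesis
      by (simp add: vec_eq_iff)
  qed
  obtain r where r: "r > 0" "\<And>q. dist q P < r \<Longrightarrow> \<forall>v\<in>part1 \<union> part4. q $ v = P $ v \<Longrightarrow>
      \<forall>(u, w)\<in>E. norm (q $ u - q $ w) = norm (P $ u - P $ w) \<Longrightarrow> q = P"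
    using inf_rigid_isolated[OF rigid] by blast
  have near: "c t = P" if "t \<in> T" "dist (c t) P < r" for t
  proof (rule r(2)[OF that(2)])
    show "\<forall>v\<in>part1 \<union> part4. c t $ v = P $ v"
      using c_ends[OF that(1)] by blast
    have "norm (c t $ u - c t $ w) = norm (P $ u - P $ w)" if "(u, w) \<in> E" for u w
    proof -
      have "norm (c t $ u - c t $ w) = norm (R t (c t $ u - c t $ w))"
        using R[OF \<open>t \<in> T\<close>] by (simp add: orthogonal_transformation)
      also have "\<dots> = norm (q t (\<phi> u) - q t (\<phi> w))"
        using lin(1)[OF \<open>t \<in> T\<close>] by (simp add: q_eq[OF \<open>t \<in> T\<close>] linear_diff)
      finally show ?thesis
        using edges[OF \<open>t \<in> T\<close> that] by (simp add: P_def)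
    qed
    then show "\<forall>(u, w)\<in>E. norm (c t $ u - c t $ w) = norm (P $ u - P $ w)"
      by blast
  qed
  have conn: "connected (c ` T)"
    using contc T(1) by (intro connected_continuous_image is_interval_connected)
  \<comment> \<open>An isolated point of the connected image of \<open>T\<close> is the whole
    image.\<close>
  have P: "{P} = c ` T \<inter> ball P r"
    using near c0 T(2) r(1) by (auto simp: dist_commute image_iff)
  have "openin (top_of_set (c ` T)) {P}"
    unfolding P by (rule openin_open_Int) simp
  moreover have "closedin (top_of_set (c ` T)) {P}"
    using c0 T(2) by (intro closed_subset) auto
  ultimately have "{P} = c ` T"
    using conn unfolding connected_clopen by blast
  then have "c t = P"
    using \<open>t \<in> T\<close> by blast
  then show ?thesis
    using q_eq[OF \<open>t \<in> T\<close>, of v] by (simp add: P_def)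
qed

text \<open>Redundant rigidity speaks of \<open>G\<close> only with an edge removed, so an edge is
  required to draw rigidity from it.\<close>

lemma k_connected_has_edge:
  assumes "k_connected k G" "k \<ge> 1"
  shows "edges G \<noteq> {}"
proof
  assume "edges G = {}"
  then have "u = v" if "u \<in> verts G" "v \<in> verts G" for u v
    using assms that by (auto simp: k_connected_def graph_connected_def remove_verts_def dest!: spec[of _ "{}"])
  then have "card (verts G) \<le> 1"
    by (metis card_le_Suc0_iff_eq One_nat_def card.infinite le0)
  then show False
    using assms by (simp add: k_connected_def)
qed

text \<open>A flexing of \<open>H\<close> without \<open>e\<close> restricts to \<open>G\<close>
  without some edge: \<open>e\<close> itself if it belongs to \<open>G\<close>, any edge otherwise.
  Hence it moves \<open>G\<close> by isometries, and the chain, even with one pair removed, follows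
  its ends.\<close>

lemma generically_redundantly_rigid_chain_attached:
  assumes att: "chain_attached \<phi> G H" and simple: "simple_graph G" and "edges G \<noteq> {}"
    and rigidG: "generically_redundantly_rigid TYPE(5) G"
  shows "generically_redundantly_rigid TYPE(5) H"
  unfolding generically_redundantly_rigid_def redundantly_rigid_def locally_rigid_def
proof (intro allI impI ballI)
  fix p :: "'a \<Rightarrow> real^5" and e T q
  assume gen: "generic_realization H p" and e: "e \<in> edges H" and flex: "flexing (remove_edge H e) p T q"
  have inj: "inj \<phi>" and vH: "verts H = verts G \<union> range \<phi>"
    and eH: "edges H = edges G \<union> (\<lambda>(w, z). {\<phi> w, \<phi> z}) ` chain_pairs"
    and pins: "\<phi> ` (part1 \<union> part4) \<subseteq> verts G"
    and new: "\<phi> ` (part2 \<union> part3) \<inter> verts G = {}"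
    using att by (auto simp: chain_attached_def)
  have alg: "alg_independent_rat (verts H \<times> UNIV) (\<lambda>(v, k). p v $ k)"
    using gen by (simp add: generic_realization_def)
  have chain_not_G: "{\<phi> w, \<phi> z} \<notin> edges G" if "(w, z) \<in> chain_pairs" for w z
  proof
    assume "{\<phi> w, \<phi> z} \<in> edges G"
    then have "\<phi> w \<in> verts G" "\<phi> z \<in> verts G"
      using simple by (auto simp: simple_graph_def)
    then show False
      using that new by (auto simp: chain_pairs_def)
  qed
  obtain e' E where e': "e' \<in> edges G" "edges (remove_edge G e') \<subseteq> edges (remove_edge H e)"
    and E: "inf_rigid (part1 \<union> part4) E (chain_conf 1)"
      "\<And>w z. (w, z) \<in> E \<Longrightarrow> {\<phi> w, \<phi> z} \<in> edges (remove_edge H e)"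
  proof (cases "e \<in> edges G")
    case True
    show thesis
    proof (rule that[of e chain_pairs])
      show "{\<phi> w, \<phi> z} \<in> edges (remove_edge H e)" if "(w, z) \<in> chain_pairs" for w z
        using that chain_not_G[OF that] True by (auto simp: remove_edge_def eH)
    qed (use True in \<open>auto simp: remove_edge_def eH inf_rigid_chain_conf\<close>)
  next
    case False
    then obtain w0 z0 where wz0: "(w0, z0) \<in> chain_pairs" "e = {\<phi> w0, \<phi> z0}"
      using e eH by auto
    obtain e' where "e' \<in> edges G"
      using \<open>edges G \<noteq> {}\<close> by blast
    show thesis
    proof (rule that[of e' "chain_pairs - {(w0, z0)}"])
      show "edges (remove_edge G e') \<subseteq> edges (remove_edge H e)"
        using False by (auto simp: remove_edge_def eH)
      show "{\<phi> w, \<phi> z} \<in> edges (remove_edge H e)" if "(w, z) \<in> chain_pairs - {(w0, z0)}" for w z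
      proof -
        \<comment> \<open>Each chain edge comes from one ordered pair only, so removing it costs a
          single pair.\<close>
        have "(z0, w0) \<notin> chain_pairs"
          using wz0(1) parts_disjoint by (auto simp: chain_pairs_def)
        then have "{\<phi> w, \<phi> z} \<noteq> e"
          using that inj by (auto simp: wz0(2) doubleton_eq_iff inj_eq)
        then show ?thesis
          using that by (auto simp: remove_edge_def eH)
      qed
    qed (fact \<open>e' \<in> edges G\<close>, fact inf_rigid_chain_conf_remove_pair)
  qed
  have "generic_realization G p"
    unfolding generic_realization_def by (rule alg_independent_rat_mono[OF alg]) (auto simp: vH)
  then have "locally_rigid (remove_edge G e') p"
    using rigidG e'(1) unfolding generically_redundantly_rigid_def redundantly_rigid_def by blast
  moreover have "flexing (remove_edge G e') p T q"
    by (rule flexing_subgraph[OF flex]) (use e'(2) in \<open>auto simp: remove_edge_def vH\<close>)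
  ultimately have "\<forall>t\<in>T. \<exists>a R. orthogonal_transformation R \<and> (\<forall>v\<in>verts G. q t v = a + R (p v))"
    unfolding locally_rigid_def trivial_flexing_def by (simp add: remove_edge_def)
  then obtain a R where R: "\<And>t. t \<in> T \<Longrightarrow> orthogonal_transformation (R t)"
    and G: "\<And>t v. t \<in> T \<Longrightarrow> v \<in> verts G \<Longrightarrow> q t v = a t + R t (p v)"
    by metis
  obtain t\<^sub>0 where t0: "t\<^sub>0 \<in> T" "\<And>v. v \<in> verts H \<Longrightarrow> q t\<^sub>0 v = p v"
    and diff: "\<And>v. v \<in> verts H \<Longrightarrow> (\<lambda>t. q t v) differentiable_on T"
    and T: "is_interval T"
    and meas: "\<And>t. t \<in> T \<Longrightarrow> measurement (remove_edge H e) (q t) = measurement (remove_edge H e) p"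
    using flex unfolding flexing_def by (auto simp: remove_edge_def)
  \<comment> \<open>The spanning condition on the ends is phrased by \<open>inf_rigid\<close>, so
    this transfer to generic positions covers it too.\<close>
  have generic: "inf_rigid B F (\<chi> v. p (\<phi> v))" if "inf_rigid B F (chain_conf 1)" for B F
    by (rule inf_rigid_generic[OF that inj _ alg]) (auto simp: vH)
  have "q t (\<phi> v) = a t + R t (p (\<phi> v))" if "t \<in> T" for t v
  proof (rule chain_follows_ends[where E = E and T = T and t\<^sub>0 = t\<^sub>0 and R = R and a = a
      and p = p and q = q and \<phi> = \<phi>])
    show "continuous_on T (\<lambda>t. q t (\<phi> v))" for v
      by (rule differentiable_imp_continuous_on[OF diff]) (simp add: vH)
    show "norm (q t (\<phi> w) - q t (\<phi> z)) = norm (p (\<phi> w) - p (\<phi> z))" if "t \<in> T" "(w, z) \<in> E" for t w z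
      using meas[OF that(1)] E(2)[OF that(2)] unfolding measurement_eq_iff by blast
    show "q t (\<phi> v) = a t + R t (p (\<phi> v))" if "t \<in> T" "v \<in> part1 \<union> part4" for t v
      using G that pins by blast
    show "inf_rigid (part1 \<union> part4) E (\<chi> v. p (\<phi> v))"
      by (rule generic[OF E(1)])
    show "inf_rigid (- {B0}) ((\<lambda>v. (v, B0)) ` (part1 \<union> part4)) (\<chi> v. p (\<phi> v))"
      by (rule generic[OF chain_conf_span])
    show "q t\<^sub>0 (\<phi> v) = p (\<phi> v)" for v
      by (rule t0(2)) (simp add: vH)
  qed (fact T t0(1) R that)+
  with G have "\<forall>v\<in>verts H. q t v = a t + R t (p v)" if "t \<in> T" for t
    using that vH by auto
  then show "trivial_flexing (remove_edge H e) p T q"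
    using R unfolding trivial_flexing_def remove_edge_def graph.simps by blast
qed

section \<open>Failure of global rigidity\<close>

lemma generic_realization_near_chain_conf:
  fixes \<phi> :: "chain_vertex \<Rightarrow> 'a"
  assumes "finite (verts H)" "inj \<phi>" "range \<phi> \<subseteq> verts H" "\<delta> > 0"
  shows "\<exists>p :: 'a \<Rightarrow> real^5. generic_realization H p \<and> dist (\<chi> v. p (\<phi> v)) c < \<delta>"
proof -
  \<comment> \<open>71 exceeds by one the number 14 * 5 of coordinates, which keeps the sum of all
    errors below \<delta>.\<close>
  obtain x where x: "alg_independent_rat (verts H \<times> (UNIV :: 5 set)) x"
    and near: "\<And>i. i \<in> verts H \<times> UNIV \<Longrightarrow> \<bar>x i - (case i of (u, k) \<Rightarrow> c $ inv \<phi> u $ k)\<bar> < \<delta> / 71"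
    using alg_independent_rat_dense[of "verts H \<times> UNIV" "\<delta> / 71" "\<lambda>(u, k). c $ inv \<phi> u $ k"] assms by auto
  define p :: "'a \<Rightarrow> real^5" where "p u = (\<chi> k. x (u, k))" for u
  have "generic_realization H p"
    using x by (simp add: generic_realization_def p_def case_prod_beta')
  moreover have "dist (\<chi> v. p (\<phi> v)) c < \<delta>"
  proof -
    have comp: "\<bar>p (\<phi> v) $ k - c $ v $ k\<bar> \<le> \<delta> / 71" for v k
    proof -
      have "\<phi> v \<in> verts H"
        using assms by auto
      then show ?thesis
        using near[of "(\<phi> v, k)"] \<open>inj \<phi>\<close> by (simp add: p_def less_imp_le)
    qed
    have "norm (p (\<phi> v) - c $ v) \<le> 5 * (\<delta> / 71)" for v
    proof -
      have "norm (p (\<phi> v) - c $ v) \<le> (\<Sum>k\<in>UNIV. \<bar>(p (\<phi> v) - c $ v) $ k\<bar>)"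
        by (rule norm_le_l1_cart)
      also have "\<dots> \<le> of_nat (card (UNIV :: 5 set)) * (\<delta> / 71)"
        by (rule sum_bounded_above) (use comp in simp)
      finally show ?thesis by simp
    qed
    note vec = this
    have "dist (\<chi> v. p (\<phi> v)) c = L2_set (\<lambda>v. norm (p (\<phi> v) - c $ v)) UNIV"
      by (simp add: dist_norm norm_vec_def)
    also have "\<dots> \<le> (\<Sum>v\<in>UNIV. norm (p (\<phi> v) - c $ v))"
      by (rule L2_set_le_sum) simp
    also have "\<dots> \<le> of_nat CARD(chain_vertex) * (5 * (\<delta> / 71))"
      by (rule sum_bounded_above) (use vec in simp)
    also have "\<dots> < \<delta>"
      using \<open>\<delta> > 0\<close> by (simp add: CARD_chain_vertex)
    finally show ?thesis .
  qed
  ultimately show ?thesis by blast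
qed

text \<open>The inner chain vertices move to an equivalent position while \<open>G\<close> stays in
  place. This is consistent because the ends do not move, and it changes the distance of
  \<open>Y3\<close> from \<open>A0\<close>.\<close>

lemma not_generically_globally_rigid_chain_attached:
  assumes att: "chain_attached \<phi> G H" and simple: "simple_graph G"
  shows "\<not> generically_globally_rigid TYPE(5) H"
proof
  assume glob: "generically_globally_rigid TYPE(5) H"
  have inj: "inj \<phi>" and vH: "verts H = verts G \<union> range \<phi>"
    and eH: "edges H = edges G \<union> (\<lambda>(w, z). {\<phi> w, \<phi> z}) ` chain_pairs"
    and new: "\<phi> ` (part2 \<union> part3) \<inter> verts G = {}"
    using att by (auto simp: chain_attached_def)
  obtain \<delta> where \<delta>: "\<delta> > 0" "\<And>p. dist p (chain_conf (-1)) < \<delta> \<Longrightarrow>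
     \<exists>q. (\<forall>v\<in>part1 \<union> part4. q $ v = p $ v) \<and>
       (\<forall>(w, z)\<in>chain_pairs. norm (q $ w - q $ z) = norm (p $ w - p $ z)) \<and>
       norm (q $ Y3 - q $ A0) \<noteq> norm (p $ Y3 - p $ A0)"
    using equivalent_chain_nearby by blast
  have "finite (verts H)"
    using simple by (simp add: vH simple_graph_def)
  then obtain p :: "'a \<Rightarrow> real^5" where p: "generic_realization H p" "dist (\<chi> v. p (\<phi> v)) (chain_conf (-1)) < \<delta>"
    using generic_realization_near_chain_conf[of H \<phi> \<delta>] inj vH \<delta>(1) by blast
  obtain c where c: "\<forall>v\<in>part1 \<union> part4. c $ v = p (\<phi> v)"
    "\<forall>(w, z)\<in>chain_pairs. norm (c $ w - c $ z) = norm (p (\<phi> w) - p (\<phi> z))"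
    "norm (c $ Y3 - c $ A0) \<noteq> norm (p (\<phi> Y3) - p (\<phi> A0))"
    using \<delta>(2)[OF p(2)] by auto
  define q where "q u = (if u \<in> range \<phi> then c $ inv \<phi> u else p u)" for u
  have q_chain: "q (\<phi> v) = c $ v" for v
    using inj by (simp add: q_def)
  have q_G: "q u = p u" if "u \<in> verts G" for u
  proof (cases "u \<in> range \<phi>")
    case True
    then obtain v where "u = \<phi> v" by blast
    moreover have "v \<in> part1 \<union> part4"
      using that new UNIV_parts \<open>u = \<phi> v\<close> by blast
    ultimately show ?thesis
      using c(1) q_chain by simp
  qed (simp add: q_def)
  have "norm (p i - p j) = norm (q i - q j)" if "{i, j} \<in> edges H" for i j
  proof (cases "{i, j} \<in> edges G")
    case True
    then have "i \<in> verts G" "j \<in> verts G"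
      using simple by (auto simp: simple_graph_def)
    then show ?thesis by (simp add: q_G)
  next
    case False
    then obtain w z where wz: "(w, z) \<in> chain_pairs" "{i, j} = {\<phi> w, \<phi> z}"
      using \<open>{i, j} \<in> edges H\<close> by (auto simp: eH)
    have "norm (c $ w - c $ z) = norm (p (\<phi> w) - p (\<phi> z))"
      using c(2) wz(1) by blast
    then show ?thesis
      using wz(2) by (auto simp: doubleton_eq_iff q_chain norm_minus_commute)
  qed
  then have "measurement H p = measurement H q"
    by (simp add: measurement_eq_iff)
  then have "norm (p (\<phi> Y3) - p (\<phi> A0)) = norm (q (\<phi> Y3) - q (\<phi> A0))"
    using glob p(1) vH unfolding generically_globally_rigid_def globally_rigid_def by blast
  then show False
    using c(3) by (simp add: q_chain)
qed

theorem theorem20: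
  fixes G H :: "'a graph"
  assumes "simple_graph G"
    and "card (verts G) \<ge> 6"
    and "generically_redundantly_rigid TYPE(5) G"
    and "k_connected 6 G"
    and "H \<in> four_chain_attachments 2 3 5 4 G"
  shows "generically_partially_rigid TYPE(5) H"
proof -
  obtain \<phi> where att: "chain_attached \<phi> G H"
    using four_chain_attachment_labelling[OF assms(5)] .
  have "edges G \<noteq> {}"
    using k_connected_has_edge[OF assms(4)] by simp
  then show ?thesis
    unfolding generically_partially_rigid_def
    using k_connected_chain_attached[OF att assms(1,4)]
      generically_redundantly_rigid_chain_attached[OF att assms(1) _ assms(3)]
      not_generically_globally_rigid_chain_attached[OF att assms(1)]
    by simp
qed

end
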